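(* Let $g(w)=w^{s-1_d}=\prod_{i=1}^d w_i^{s_i-1}$ with $s\in\mathbb R^d$, $s_i>0$ for all $i$ (i.e. $g\in\mathcal M^d$). (1) Let $f(w)\in\mathcal{SP}^{d,2}_{\ge0}$ be a non-negative sum-of-products binomial. If the algorithm "blow-up between terms" is applied to $(f,g)$, the algorithm returns a finite blow-up tree $\mathcal T=(V,E)$ such that for every leaf $(h,k)$ of $\mathcal T$ the binomial $h$ is a normal crossing. (2) Let $f(w)\in\mathcal{SP}^{d,n}_{\ge0}$ be a non-negative sum-of-products polynomial. If the algorithm "local normal crossing blow-up" is applied to $(f,g)$, the algorithm returns a finite blow-up tree $\mathcal T=(V,E)$ such that for every leaf $(h,k)$ of $\mathcal T$ the polynomial $h$ is a local normal crossing.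
   Context: Notation: $\mathbb N_0$ is the set of non-negative integers; $w^a=\prod_{i=1}^d w_i^{a_i}$; $1_d$ is the all-ones vector. A sum-of-products (sop) polynomial with $d$ variables and $n$ terms is $f(w)=\sum_{j=1}^n w^{a_{*j}}$ with pairwise distinct exponent vectors $a_{*j}\in\mathbb N_0^d$ (all coefficients equal to $1$). $\mathcal{SP}^{d,n}$ is the set of these, and $\mathcal{SP}^{d,n}_{\ge0}$ the subset of those with $f\ge0$ on $\mathbb R^d$. $\mathcal M^d=\{\prod_{i=1}^d w_i^{s_i-1}: s_i>0\ (i=1,\dots,d)\}$. For monomials, $w^a\le w^b$ means $a\le b$ componentwise. Normal crossing: a function $u(w)w^k$ with $k\in\mathbb N_0^d$ and $u$ an analytic function that is everywhere positive or everywhere negative. Local normal crossing (near the origin): a function $u(w)w^k$ with $k\in\mathbb N_0^d$ and $u$ analytic and non-zero on some neighbourhood of the origin. Blow-up step. For a pair $(h,k)$ ($h$ a polynomial, $k\in\mathcal M^d$) and two variables $w_i,w_j$ ($i\neq j$), blowing up with center $\{w_i=w_j=0\}$ creates two children, one per chart: (a) substitute $w_iw_j$ for $w_i$ in $h$ and $k$, and multiply the new $k$ by the Jacobian factor $w_j$; (b) substitute $w_iw_j$ for $w_j$ in $h$ and $k$, and multiply the new $k$ by the Jacobian factor $w_i$. A blow-up tree has such pairs as nodes, with edges from a node to its children; leaves are the nodes without children. Algorithm A ("blow-up between variables with Jacobian"). Input: a non-negative sop binomial $f$ in two variables $w_1,w_2$ and a monomial $g\in\mathcal M^2$. Start from the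 root $(f,g)$. At a node $(h,k)$: if $h$ is a normal crossing, no more blow-up is performed in the branch; if not, blow up with center the origin $\{w_1=w_2=0\}$ and repeat the procedure for each of the two children. Output: the resulting tree. Algorithm B ("blow-up between terms"). Input: a non-negative sop binomial $f\in\mathcal{SP}^{d,2}_{\ge0}$ and $g\in\mathcal M^d$. Start from the root $(f,g)$. At a node $(h,k)$: if $h$ is a normal crossing, no more blow-up is performed in the branch. If not, factor out the common factor, $h=c(p_1+p_2)$ with monomials $c,p_1,p_2$, where $p_1$ and $p_2$ are prime to each other; let $s_1$ and $s_2$ be variables of maximum degree in $p_1$ and $p_2$ respectively; run Algorithm A for the polynomial $h$, the monomial $k$ and the two variables $s_1,s_2$ (in the role of $w_1,w_2$, $h$ being treated as a binomial in these two variables); attach the resulting tree at $(h,k)$ and repeat the procedure for each of its leaves. Output: the resulting tree. Algorithm C ("local normal crossing blow-up"). Input: $f\in\mathcal{SP}^{d,n}_{\ge0}$ and $g\in\mathcal M^d$. Start from the root $(f,g)$ with counters $n_1=1$, $n_2=2$. At a node $(h,k)$ with counters $(n_1,n_2)$: if $h$ is a local normal crossing, no more blow-up is performed in the branch. If not, expand $h=p_1+\cdots+p_n$ as a sum of monomials (in the order inherited from the terms of $f$) and run Algorithm B on $(p_{n_1}+p_{n_2},k)$. Apply the same variable transformations to the whole of $h$: for each node $(h',k')$ of the tree so obtained, with $h'=(p_{n_1}+p_{n_2})\circ\phi$, the pair $(h\circ\phi,k')$ is a node of the tree being built. At each leaf $(h',k')$ of that tree, with transformed monomials $p'_1,\dots,p'_n$,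 update the counters: if $p'_{n_1}\le p'_{n_2}$, to $(n_1,\max\{n_1,n_2\}+1)$; otherwise to $(\max\{n_1,n_2\}+1,n_2)$. Repeat the procedure for each such $(h\circ\phi,k')$. Output: the resulting tree.
   Formalization: In "local normal crossing blow-up", when p_{n1}+p_{n2} is not a non-negative binomial, "blow-up between terms" is run with local normal crossing as stopping test; with the stated normal crossing test it need not terminate, e.g. f = w_1^2+w_1w_2+w_2^2. *)

theory Defs
  imports "HOL-Analysis.Analysis"
begin

section \<open>Sum-of-products polynomials\<close>

definition monomial :: "nat ^ 'd \<Rightarrow> real ^ 'd \<Rightarrow> real" where
  "monomial a w = (\<Prod>i\<in>UNIV. (w $ i) ^ (a $ i))"

text \<open>
  A sop polynomial is represented by the list of the exponent vectors of its terms.  The order of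
  the list is the order of the terms (which matters for \<open>alg_C\<close>); the polynomial function is \<open>sop\<close>.
\<close>

definition sop :: "(nat ^ 'd) list \<Rightarrow> real ^ 'd \<Rightarrow> real" where
  "sop h w = (\<Sum>a\<leftarrow>h. monomial a w)"

definition SP :: "nat \<Rightarrow> (nat ^ 'd) list set" where
  "SP n = {f. length f = n \<and> distinct f}"

definition SP_nonneg :: "nat \<Rightarrow> (nat ^ 'd) list set" where
  "SP_nonneg n = {f \<in> SP n. \<forall>w. sop f w \<ge> 0}"

section \<open>Normal crossings\<close>

text \<open>
  Real analyticity on an open set: local expansion into an (unconditionally convergent) power
  series in several variables.
\<close>

definition real_analytic_on :: "(real ^ 'd \<Rightarrow> real) \<Rightarrow> (real ^ 'd) set \<Rightarrow> bool" where
  "real_analytic_on u U \<longleftrightarrow>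
     (\<forall>x\<in>U. \<exists>r>0. \<exists>c :: nat ^ 'd \<Rightarrow> real. \<forall>w\<in>ball x r.
        ((\<lambda>\<alpha>. c \<alpha> * monomial \<alpha> (w - x)) has_sum u w) UNIV)"

definition normal_crossing :: "(real ^ 'd \<Rightarrow> real) \<Rightarrow> bool" where
  "normal_crossing F \<longleftrightarrow>
     (\<exists>u k. real_analytic_on u UNIV \<and> ((\<forall>w. u w > 0) \<or> (\<forall>w. u w < 0)) \<and>
        (\<forall>w. F w = u w * monomial k w))"

definition local_normal_crossing :: "(real ^ 'd \<Rightarrow> real) \<Rightarrow> bool" where
  "local_normal_crossing F \<longleftrightarrow>
     (\<exists>u k U. open U \<and> 0 \<in> U \<and> real_analytic_on u U \<and> (\<forall>w\<in>U. u w \<noteq> 0) \<and>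
        (\<forall>w\<in>U. F w = u w * monomial k w))"

section \<open>Blow-up steps and blow-up trees\<close>

text \<open>
  A pair \<open>(i, j)\<close> stands for the chart in which \<open>w\<^sub>i w\<^sub>j\<close> is substituted for \<open>w\<^sub>i\<close>;
  \<open>subst_exp\<close> is its effect on exponent vectors (natural or real).
\<close>

type_synonym 'd chart = "'d \<times> 'd"

definition chart_map :: "'d chart \<Rightarrow> real ^ 'd \<Rightarrow> real ^ 'd" where
  "chart_map e w = (\<chi> l. if l = fst e then w $ fst e * w $ snd e else w $ l)"

definition subst_exp :: "'d chart \<Rightarrow> ('a::plus) ^ 'd \<Rightarrow> 'a ^ 'd" where
  "subst_exp e a = (\<chi> l. if l = snd e then a $ fst e + a $ snd e else a $ l)"

text \<open>
  A pair \<open>(h, k)\<close>: the second component is the exponent vector \<open>s - 1\<close> of the monomial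
  \<open>w\<^sup>(\<^sup>s\<^sup>-\<^sup>1\<^sup>)\<close>, whose exponents are real.
\<close>

type_synonym 'd pair = "(nat ^ 'd) list \<times> (real ^ 'd)"

definition blow_up :: "('d::finite) chart \<Rightarrow> 'd pair \<Rightarrow> 'd pair" where
  "blow_up e x = (map (subst_exp e) (fst x), subst_exp e (snd x) + axis (snd e) 1)"

lemma monomial_subst_exp:
  assumes "i \<noteq> j"
  shows "monomial (subst_exp (i, j) a) w = monomial a (chart_map (i, j) w)"
proof -
  have split: "(\<Prod>l\<in>UNIV. G l) = G i * (G j * (\<Prod>l\<in>UNIV - {i} - {j}. G l))" for G :: "'a \<Rightarrow> real"
    using assms by (simp add: prod.remove[of UNIV i] prod.remove[of "UNIV - {i}" j])
  have rest: "(\<Prod>l\<in>UNIV - {i} - {j}. w $ l ^ subst_exp (i, j) a $ l)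
            = (\<Prod>l\<in>UNIV - {i} - {j}. chart_map (i, j) w $ l ^ a $ l)"
    by (rule prod.cong) (auto simp: subst_exp_def chart_map_def)
  show ?thesis
    using assms unfolding monomial_def split rest
    by (simp add: subst_exp_def chart_map_def power_add power_mult_distrib)
qed

lemma sop_blow_up:
  assumes "i \<noteq> j"
  shows "sop (fst (blow_up (i, j) x)) w = sop (fst x) (chart_map (i, j) w)"
  using monomial_subst_exp[OF assms] by (simp add: sop_def blow_up_def o_def)

lemma monomial_blow_up_jacobian:
  assumes "i \<noteq> j" and pos: "\<And>l. w $ l > 0"
  shows "(\<Prod>l\<in>UNIV. w $ l powr (snd (blow_up (i, j) x) $ l))
       = (\<Prod>l\<in>UNIV. chart_map (i, j) w $ l powr (snd x $ l)) * w $ j"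
proof -
  have split: "(\<Prod>l\<in>UNIV. G l) = G i * (G j * (\<Prod>l\<in>UNIV - {i} - {j}. G l))" for G :: "'a \<Rightarrow> real"
    using assms(1) by (simp add: prod.remove[of UNIV i] prod.remove[of "UNIV - {i}" j])
  have rest: "(\<Prod>l\<in>UNIV - {i} - {j}. w $ l powr (snd (blow_up (i, j) x) $ l))
            = (\<Prod>l\<in>UNIV - {i} - {j}. chart_map (i, j) w $ l powr (snd x $ l))"
    by (rule prod.cong) (auto simp: blow_up_def subst_exp_def chart_map_def axis_def)
  have "0 < w $ i" "0 < w $ j" by (rule pos)+
  with assms(1) show ?thesis
    unfolding split rest
    by (simp add: blow_up_def subst_exp_def chart_map_def axis_def powr_add powr_mult)
qed

text \<open>
  A node of a blow-up tree is addressed by the word of charts leading to it from the root, so that a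
  (possibly infinite) tree is a set of words.  The pair at the node \<open>v\<close> of a tree with root
  pair \<open>x\<close> is \<open>pair_at x v\<close>.
\<close>

type_synonym 'd tree = "'d chart list set"

definition pair_at :: "('d::finite) pair \<Rightarrow> 'd chart list \<Rightarrow> 'd pair" where
  "pair_at x v = fold blow_up v x"

abbreviation poly_at :: "('d::finite) pair \<Rightarrow> 'd chart list \<Rightarrow> (nat ^ 'd) list" where
  "poly_at x v \<equiv> fst (pair_at x v)"

definition edges :: "'d tree \<Rightarrow> ('d chart list \<times> 'd chart list) set" where
  "edges V = {(v, v @ [e]) | v e. v \<in> V \<and> v @ [e] \<in> V}"

definition leaves :: "'d tree \<Rightarrow> 'd chart list set" where
  "leaves V = {v \<in> V. \<forall>u. (v, u) \<notin> edges V}"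

definition blow_up_tree :: "'d tree \<Rightarrow> bool" where
  "blow_up_tree V \<longleftrightarrow>
     [] \<in> V \<and> (\<forall>v e. v @ [e] \<in> V \<longrightarrow> v \<in> V) \<and>
     (\<forall>v \<in> V - leaves V. \<exists>i j. i \<noteq> j \<and> {u. (v, u) \<in> edges V} = {v @ [(i, j)], v @ [(j, i)]})"

section \<open>Blow-up between variables with Jacobian\<close>

text \<open>
  \<open>N\<close> is the stopping test.  A binomial in \<open>d\<close> variables is treated as a binomial in
  \<open>w\<^sub>i, w\<^sub>j\<close> by regarding the other variables as non-zero constants, i.e. by applying the
  test after setting them to 1.  Testing the binomial in all \<open>d\<close> variables instead would not
  terminate: for \<open>w\<^sub>1\<^sup>2 w\<^sub>3\<^sup>2 + w\<^sub>2\<^sup>2\<close> one chart gives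
  \<open>w\<^sub>1\<^sup>2 (w\<^sub>3\<^sup>2 + w\<^sub>2\<^sup>2)\<close>, which no blow-up in \<open>w\<^sub>1, w\<^sub>2\<close>
  makes a normal crossing in all charts.
\<close>

definition restrict_vars :: "'d set \<Rightarrow> nat ^ 'd \<Rightarrow> nat ^ 'd" where
  "restrict_vars S a = (\<chi> l. if l \<in> S then a $ l else 0)"

inductive_set alg_A :: "((real ^ 'd \<Rightarrow> real) \<Rightarrow> bool) \<Rightarrow> 'd \<Rightarrow> 'd \<Rightarrow> 'd pair \<Rightarrow> 'd tree"
  for N :: "(real ^ 'd \<Rightarrow> real) \<Rightarrow> bool" and i j :: 'd and x :: "'d pair"
where
  root: "[] \<in> alg_A N i j x"
| child: "\<lbrakk>v \<in> alg_A N i j x; \<not> N (sop (map (restrict_vars {i, j}) (poly_at x v)));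
           e \<in> {(i, j), (j, i)}\<rbrakk> \<Longrightarrow> v @ [e] \<in> alg_A N i j x"

section \<open>Blow-up between terms\<close>

definition max_degree_vars :: "(nat ^ 'd) list \<Rightarrow> 'd \<times> 'd \<Rightarrow> bool" where
  "max_degree_vars h s \<longleftrightarrow>
     (\<exists>c p1 p2. h = [c + p1, c + p2] \<and> (\<forall>i. p1 $ i = 0 \<or> p2 $ i = 0) \<and>
        (\<forall>i. p1 $ i \<le> p1 $ fst s) \<and> (\<forall>i. p2 $ i \<le> p2 $ snd s))"

text \<open>
  \<open>stages_B\<close> collects the nodes at which the procedure is (re)started; \<open>\<sigma>\<close> gives the two
  variables chosen at each of them.
\<close>

inductive_set stages_B ::
  "((real ^ 'd \<Rightarrow> real) \<Rightarrow> bool) \<Rightarrow> ('d chart list \<Rightarrow> 'd \<times> 'd) \<Rightarrow> 'd pair \<Rightarrow> 'd chart list set"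
  for N :: "(real ^ 'd \<Rightarrow> real) \<Rightarrow> bool" and \<sigma> :: "'d chart list \<Rightarrow> 'd \<times> 'd" and x :: "'d pair"
where
  root: "[] \<in> stages_B N \<sigma> x"
| next_stage: "\<lbrakk>v \<in> stages_B N \<sigma> x; \<not> N (sop (poly_at x v));
    u \<in> leaves (alg_A N (fst (\<sigma> v)) (snd (\<sigma> v)) (pair_at x v))\<rbrakk> \<Longrightarrow> v @ u \<in> stages_B N \<sigma> x"

definition tree_B ::
  "((real ^ 'd \<Rightarrow> real) \<Rightarrow> bool) \<Rightarrow> ('d chart list \<Rightarrow> 'd \<times> 'd) \<Rightarrow> 'd pair \<Rightarrow> 'd tree" where
  "tree_B N \<sigma> x = stages_B N \<sigma> x \<union>
     {v @ u | v u. v \<in> stages_B N \<sigma> x \<and> \<not> N (sop (poly_at x v)) \<and>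
        u \<in> alg_A N (fst (\<sigma> v)) (snd (\<sigma> v)) (pair_at x v)}"

text \<open>
  \<open>alg_B N x V\<close>: for some way of choosing among the variables of maximum degree, the tree produced
  from the root \<open>x\<close> is \<open>V\<close>.
\<close>

definition alg_B :: "((real ^ 'd \<Rightarrow> real) \<Rightarrow> bool) \<Rightarrow> 'd pair \<Rightarrow> 'd tree \<Rightarrow> bool" where
  "alg_B N x V \<longleftrightarrow>
     (\<exists>\<sigma>. (\<forall>v \<in> stages_B N \<sigma> x. \<not> N (sop (poly_at x v)) \<longrightarrow> max_degree_vars (poly_at x v) (\<sigma> v)) \<and>
        V = tree_B N \<sigma> x)"

section \<open>Local normal crossing blow-up\<close>

text \<open>
  A stage \<open>(v, n1, n2)\<close> is a node together with the counters (starting from 1) with which the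
  procedure is (re)started there.
\<close>

type_synonym 'd stage = "'d chart list \<times> nat \<times> nat"

fun active :: "('d::finite) pair \<Rightarrow> 'd stage \<Rightarrow> bool" where
  "active x (v, n1, n2) \<longleftrightarrow> \<not> local_normal_crossing (sop (poly_at x v)) \<and>
     n1 \<le> length (fst x) \<and> n2 \<le> length (fst x)"

fun subproblem :: "('d::finite) pair \<Rightarrow> 'd stage \<Rightarrow> 'd pair" where
  "subproblem x (v, n1, n2) =
     ([poly_at x v ! (n1 - 1), poly_at x v ! (n2 - 1)], snd (pair_at x v))"

text \<open>
  A non-negative \<open>f\<close> may have terms whose pairwise sums are not non-negative, such as
  \<open>w\<^sub>1\<^sup>2 + w\<^sub>1 w\<^sub>2\<close> for \<open>w\<^sub>1\<^sup>2 + w\<^sub>1 w\<^sub>2 + w\<^sub>2\<^sup>2\<close>.  For these the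
  blow-up between terms, specified for non-negative binomials, is run with local normal crossings
  in place of normal crossings, which the sum of two such terms may never reach
  (\<open>w\<^sub>1 w\<^sub>2\<^sup>2 (w\<^sub>1 + 1)\<close>).  For non-negative binomials it is run as it stands.
\<close>

definition stopping_test :: "(nat ^ 'd) list \<Rightarrow> (real ^ 'd \<Rightarrow> real) \<Rightarrow> bool" where
  "stopping_test b = (if b \<in> SP_nonneg 2 then normal_crossing else local_normal_crossing)"

fun next_counters :: "(nat ^ 'd) list \<Rightarrow> nat \<times> nat \<Rightarrow> nat \<times> nat" where
  "next_counters h (n1, n2) =
     (if h ! (n1 - 1) \<le> h ! (n2 - 1) then (n1, max n1 n2 + 1) else (max n1 n2 + 1, n2))"

text \<open>
  \<open>\<T>\<close> gives the tree returned by the blow-up between terms at each stage.  As nodes are words of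
  charts, the word of a node of that tree is also the variable transformation applied to all of \<open>h\<close>.
\<close>

inductive_set stages_C :: "(('d::finite) stage \<Rightarrow> 'd tree) \<Rightarrow> 'd pair \<Rightarrow> 'd stage set"
  for \<T> :: "'d stage \<Rightarrow> 'd tree" and x :: "'d pair"
where
  root: "([], 1, 2) \<in> stages_C \<T> x"
| next_stage: "\<lbrakk>(v, n1, n2) \<in> stages_C \<T> x; active x (v, n1, n2); u \<in> leaves (\<T> (v, n1, n2))\<rbrakk>
    \<Longrightarrow> (v @ u, next_counters (poly_at x (v @ u)) (n1, n2)) \<in> stages_C \<T> x"

definition tree_C :: "(('d::finite) stage \<Rightarrow> 'd tree) \<Rightarrow> 'd pair \<Rightarrow> 'd tree" where
  "tree_C \<T> x = fst ` stages_C \<T> x \<union>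
     {fst t @ u | t u. t \<in> stages_C \<T> x \<and> active x t \<and> u \<in> \<T> t}"

definition alg_C :: "('d::finite) pair \<Rightarrow> 'd tree \<Rightarrow> bool" where
  "alg_C x V \<longleftrightarrow>
     (\<exists>\<T>. (\<forall>t \<in> stages_C \<T> x. active x t \<longrightarrow>
             alg_B (stopping_test (fst (subproblem x t))) (subproblem x t) (\<T> t)) \<and>
        V = tree_C \<T> x)"

end

theory Submission
  imports Defs
begin

text \<open>
  A binomial \<open>w\<^sup>a + w\<^sup>b\<close> is a local normal crossing exactly when \<open>a \<le> b\<close> or
  \<open>b \<le> a\<close>, and a non-negative one has even exponents only, so that for it the same holds with
  normal crossings.  Everything thus becomes combinatorics of \<open>\<delta> = a - b\<close>, on which the chart
  \<open>(i, j)\<close> acts by \<open>\<delta>\<^sub>j := \<delta>\<^sub>i + \<delta>\<^sub>j\<close>.  Blow-up between two variables with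
  \<open>\<delta>\<^sub>i > 0 > \<delta>\<^sub>j\<close> is a Euclidean algorithm on \<open>|\<delta>\<^sub>i|, |\<delta>\<^sub>j|\<close> that ends with equal
  signs: one of the two entries has left its side (positive or negative), and on the other side the
  new entry is smaller than the old maximum.  Since the variables have maximum degree, the pair
  (maximum, number of times it is attained) does not increase on either side and decreases on one.
  For several terms, each stage compares the term dividing all earlier ones with the next term.
\<close>

section \<open>Trees grown in stages\<close>

lemma leaves_iff: "v \<in> leaves V \<longleftrightarrow> v \<in> V \<and> {e. v @ [e] \<in> V} = {}"
  by (auto simp: leaves_def edges_def)

text \<open>Recording children by their charts instead of by their words makes the condition
  independent of a prefix common to all words.\<close>

lemma blow_up_tree_iff:
  "blow_up_tree V \<longleftrightarrow>
     [] \<in> V \<and> (\<forall>v e. v @ [e] \<in> V \<longrightarrow> v \<in> V) \<and>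
     (\<forall>v \<in> V. {e. v @ [e] \<in> V} = {} \<or> (\<exists>i j. i \<noteq> j \<and> {e. v @ [e] \<in> V} = {(i, j), (j, i)}))"
proof -
  have "{u. (v, u) \<in> edges V} = {v @ [(i, j)], v @ [(j, i)]} \<longleftrightarrow> {e. v @ [e] \<in> V} = {(i, j), (j, i)}"
    if "v \<in> V" for v i j
  proof -
    have img: "{u. (v, u) \<in> edges V} = (\<lambda>e. v @ [e]) ` {e. v @ [e] \<in> V}"
      using that by (auto simp: edges_def)
    have two: "{v @ [(i, j)], v @ [(j, i)]} = (\<lambda>e. v @ [e]) ` {(i, j), (j, i)}"
      by simp
    show ?thesis
      unfolding img two by (rule inj_image_eq_iff) (simp add: inj_def)
  qed
  then have "(v \<in> V - leaves V \<longrightarrow> (\<exists>i j. i \<noteq> j \<and> {u. (v, u) \<in> edges V} = {v @ [(i, j)], v @ [(j, i)]})) \<longleftrightarrow>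
      (v \<in> V \<longrightarrow> {e. v @ [e] \<in> V} = {} \<or> (\<exists>i j. i \<noteq> j \<and> {e. v @ [e] \<in> V} = {(i, j), (j, i)}))" for v
    by (cases "v \<in> V") (simp_all only: Diff_iff leaves_iff simp_thms imp_conv_disj)
  then show ?thesis
    unfolding blow_up_tree_def Ball_def by simp
qed

lemma blow_up_tree_prefix: "blow_up_tree V \<Longrightarrow> v @ w \<in> V \<Longrightarrow> v \<in> V"
proof (induction w rule: rev_induct)
  case (snoc e w)
  then have "(v @ w) @ [e] \<in> V" by simp
  with snoc show ?case unfolding blow_up_tree_def by blast
qed simp

lemma leaf_extension:
  assumes "blow_up_tree V" "u \<in> leaves V" "u @ w \<in> V"
  shows "w = []"
proof (cases w)
  case (Cons e w')
  then have "(u @ [e]) @ w' \<in> V" using assms(3) by simp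
  then have "u @ [e] \<in> V" by (rule blow_up_tree_prefix[OF assms(1)])
  then show ?thesis using assms(2) unfolding leaves_iff by blast
qed simp

text \<open>Of two prefixes of the same word one extends the other, and a leaf has no proper
  extension in the tree.\<close>

lemma leaf_prefix_unique:
  assumes V: "blow_up_tree V" "u \<in> leaves V" "u' \<in> leaves V" and eq: "u @ w = u' @ w'"
  shows "u = u'"
proof -
  have "u \<in> V" "u' \<in> V" using V by (auto simp: leaves_iff)
  moreover obtain us where "u = u' @ us \<and> us @ w = w' \<or> u @ us = u' \<and> w = us @ w'"
    using eq by (auto simp: append_eq_append_conv2)
  ultimately show ?thesis using leaf_extension V by (metis append.right_neutral)
qed

section \<open>Attaching trees at the leaves of a tree\<close>

definition graft :: "'d tree \<Rightarrow> ('d chart list \<Rightarrow> 'd tree) \<Rightarrow> 'd tree" where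
  "graft V W = V \<union> {u @ w | u w. u \<in> leaves V \<and> w \<in> W u}"

lemma graft_set: "{u @ w | u w. u \<in> U \<and> w \<in> W u} = (\<Union>u\<in>U. (@) u ` W u)"
  by auto

text \<open>Since the leaf prefix of a word is unique, the children of a node come from
  \<open>V\<close> alone before a leaf is reached, and from the single tree \<open>W u\<close> from
  the leaf \<open>u\<close> on.\<close>

lemma graft_props:
  assumes V: "blow_up_tree V" and W: "\<And>u. u \<in> leaves V \<Longrightarrow> blow_up_tree (W u)"
  shows blow_up_tree_graft: "blow_up_tree (graft V W)"
    and leaves_graft: "leaves (graft V W) = {u @ w | u w. u \<in> leaves V \<and> w \<in> leaves (W u)}"
proof -
  let ?G = "graft V W"
  have child_inner: "{e. v @ [e] \<in> ?G} = {e. v @ [e] \<in> V}" if v: "v \<in> V - leaves V" for v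
  proof -
    have "v @ [e] \<in> V" if u: "u \<in> leaves V" and eq: "v @ [e] = u @ w" for e u w
    proof (cases w rule: rev_cases)
      case Nil
      with eq u show ?thesis by (auto simp: leaves_iff)
    next
      case (snoc w' e')
      with eq have "v = u @ w'" by simp
      moreover from this have "w' = []" using leaf_extension[OF V u] v by simp
      ultimately show ?thesis using u v by simp
    qed
    then show ?thesis unfolding graft_def by auto
  qed
  have child_outer: "{e. (u @ w) @ [e] \<in> ?G} = {e. w @ [e] \<in> W u}" if u: "u \<in> leaves V" for u w
  proof -
    have "(u @ w) @ [e] \<notin> V" for e
      using leaf_extension[OF V u, of "w @ [e]"] by auto
    moreover have "w @ [e] \<in> W u"
      if "u' \<in> leaves V" "w' \<in> W u'" "(u @ w) @ [e] = u' @ w'" for e u' w'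
      using leaf_prefix_unique[OF V u that(1), of "w @ [e]" w'] that by auto
    ultimately show ?thesis using u unfolding graft_def by auto
  qed
  \<comment> \<open>A leaf \<open>u\<close> of \<open>V\<close> is counted as the root of
    \<open>W u\<close>, which makes the two alternatives exclusive.\<close>
  have nodes: "v \<in> ?G \<longleftrightarrow> v \<in> V - leaves V \<or> (\<exists>u w. v = u @ w \<and> u \<in> leaves V \<and> w \<in> W u)" for v
  proof -
    have "\<exists>u w. v = u @ w \<and> u \<in> leaves V \<and> w \<in> W u" if "v \<in> leaves V"
      using W[OF that] that by (intro exI[of _ v] exI[of _ "[]"]) (simp add: blow_up_tree_iff)
    then show ?thesis unfolding graft_def by auto
  qed
  have root: "[] \<in> V" and down: "\<And>v e. v @ [e] \<in> V \<Longrightarrow> v \<in> V"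
    using V unfolding blow_up_tree_iff by blast+
  show "blow_up_tree ?G"
    unfolding blow_up_tree_iff
  proof (intro conjI allI impI ballI)
    show "[] \<in> ?G" using root by (simp add: graft_def)
  next
    fix v e assume ve: "v @ [e] \<in> ?G"
    show "v \<in> ?G"
    proof (cases "v @ [e] \<in> V")
      case True
      then show ?thesis using down unfolding graft_def by blast
    next
      case False
      with ve obtain u w where uw: "v @ [e] = u @ w" "u \<in> leaves V" "w \<in> W u"
        by (auto simp: graft_def)
      then obtain w' where w: "w = w' @ [e]" "v = u @ w'"
        using False by (cases w rule: rev_cases) (auto simp: leaves_iff)
      then have "w' \<in> W u" using W[OF uw(2)] uw(3) unfolding blow_up_tree_iff by blast
      then show ?thesis using w uw unfolding graft_def by blast
    qed
  next
    fix v assume "v \<in> ?G"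
    then consider "v \<in> V - leaves V" | u w where "v = u @ w" "u \<in> leaves V" "w \<in> W u"
      unfolding nodes by blast
    then show "{e. v @ [e] \<in> ?G} = {} \<or> (\<exists>i j. i \<noteq> j \<and> {e. v @ [e] \<in> ?G} = {(i, j), (j, i)})"
    proof cases
      case 1
      then show ?thesis using V unfolding child_inner[OF 1] blow_up_tree_iff by blast
    next
      case 2
      then show ?thesis
        using W[OF 2(2)] unfolding 2(1) child_outer[OF 2(2)] blow_up_tree_iff by blast
    qed
  qed
  show "leaves ?G = {u @ w | u w. u \<in> leaves V \<and> w \<in> leaves (W u)}"
  proof (intro set_eqI iffI)
    fix v assume v: "v \<in> leaves ?G"
    then have "v \<in> ?G" by (simp add: leaves_iff)
    then consider "v \<in> V - leaves V" | u w where "v = u @ w" "u \<in> leaves V" "w \<in> W u"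
      unfolding nodes by blast
    then show "v \<in> {u @ w | u w. u \<in> leaves V \<and> w \<in> leaves (W u)}"
    proof cases
      case 1
      then show ?thesis using v child_inner[OF 1] by (simp add: leaves_iff)
    next
      case 2
      then have "w \<in> leaves (W u)"
        using v 2(3) unfolding 2(1) leaves_iff child_outer[OF 2(2)] by blast
      then show ?thesis using 2 by blast
    qed
  next
    fix v assume "v \<in> {u @ w | u w. u \<in> leaves V \<and> w \<in> leaves (W u)}"
    then obtain u w where v: "v = u @ w" "u \<in> leaves V" "w \<in> leaves (W u)" by blast
    then have "v \<in> ?G" unfolding nodes leaves_iff by blast
    moreover have "{e. v @ [e] \<in> ?G} = {}"
      using v(3) unfolding v(1) leaves_iff child_outer[OF v(2)] by blast
    ultimately show "v \<in> leaves ?G" unfolding leaves_iff by blast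
  qed
qed

lemma finite_graft:
  assumes "finite V" "\<And>u. u \<in> leaves V \<Longrightarrow> finite (W u)"
  shows "finite (graft V W)"
proof -
  have "finite (leaves V)"
    using assms(1) by (rule finite_subset[rotated]) (auto simp: leaves_iff)
  moreover have "graft V W = V \<union> (\<Union>u\<in>leaves V. (@) u ` W u)" by (auto simp: graft_def)
  ultimately show ?thesis using assms by auto
qed

text \<open>
  All three algorithms attach the tree \<open>T t\<close> at the node of an active stage \<open>t\<close> and continue from
  each of its leaves \<open>u\<close> with the stage \<open>nxt t u\<close>; a node may carry several stages, because
  \<open>T t\<close> may be the one-node tree.
\<close>

inductive_set reach ::
  "('s \<Rightarrow> bool) \<Rightarrow> ('s \<Rightarrow> 'd tree) \<Rightarrow> ('s \<Rightarrow> 'd chart list \<Rightarrow> 's) \<Rightarrow> 's \<Rightarrow> 's set"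
  for act T nxt t0
where
  root: "t0 \<in> reach act T nxt t0"
| step: "\<lbrakk>t \<in> reach act T nxt t0; act t; u \<in> leaves (T t)\<rbrakk> \<Longrightarrow> nxt t u \<in> reach act T nxt t0"

lemma reach_inactive: "\<not> act t0 \<Longrightarrow> reach act T nxt t0 = {t0}"
proof -
  assume inactive: "\<not> act t0"
  have "t = t0" if "t \<in> reach act T nxt t0" for t
    using that by induction (use inactive in auto)
  then show ?thesis by (auto intro: reach.root)
qed

text \<open>The inductive definition adds stages at the end; the induction on the start stage needs
  the first stage peeled off instead.\<close>

lemma reach_active:
  assumes "act t0"
  shows "reach act T nxt t0 = insert t0 (\<Union>u\<in>leaves (T t0). reach act T nxt (nxt t0 u))"
proof (intro equalityI subsetI)
  fix t assume "t \<in> reach act T nxt t0"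
  then show "t \<in> insert t0 (\<Union>u\<in>leaves (T t0). reach act T nxt (nxt t0 u))"
    by induction (auto intro: reach.intros)
next
  fix t assume t: "t \<in> insert t0 (\<Union>u\<in>leaves (T t0). reach act T nxt (nxt t0 u))"
  have "t \<in> reach act T nxt t0" if "u \<in> leaves (T t0)" "t \<in> reach act T nxt (nxt t0 u)" for u
    using that(2) by induction (auto intro: reach.intros assms that(1))
  with t show "t \<in> reach act T nxt t0" by (auto intro: reach.root)
qed

lemma reach_invariant:
  assumes "t \<in> reach act T nxt t0" "Inv t0"
    and "\<And>t u. \<lbrakk>Inv t; act t; u \<in> leaves (T t)\<rbrakk> \<Longrightarrow> Inv (nxt t u)"
  shows "Inv t"
  using assms(1) by induction (use assms(2,3) in auto)

text \<open>\<open>node\<close> is kept apart from the stage because the stages of Algorithm C carry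
  counters as well.\<close>

definition staged_tree ::
  "('s \<Rightarrow> bool) \<Rightarrow> ('s \<Rightarrow> 'd tree) \<Rightarrow> ('s \<Rightarrow> 'd chart list \<Rightarrow> 's) \<Rightarrow> ('s \<Rightarrow> 'd chart list) \<Rightarrow> 's \<Rightarrow> 'd tree"
where
  "staged_tree act T nxt node t0 =
     node ` reach act T nxt t0 \<union> {node t @ u | t u. t \<in> reach act T nxt t0 \<and> act t \<and> u \<in> T t}"

lemma staged_tree_active:
  assumes "act t0" and "[] \<in> T t0"
  shows "staged_tree act T nxt node t0 =
    (@) (node t0) ` T t0 \<union> (\<Union>u\<in>leaves (T t0). staged_tree act T nxt node (nxt t0 u))"
proof -
  have "staged_tree act T nxt node s =
      (\<Union>t \<in> reach act T nxt s. insert (node t) {node t @ u | u. act t \<and> u \<in> T t})" for s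
    unfolding staged_tree_def by blast
  moreover have "node t0 \<in> (@) (node t0) ` T t0"
    using assms(2) by (rule rev_image_eqI) simp
  ultimately show ?thesis
    using assms(1) by (simp add: reach_active insert_absorb setcompr_eq_image)
qed

text \<open>Induction on \<open>m\<close>: the trees started at the leaves of \<open>T t0\<close>
  are finite by the induction hypothesis, and the whole tree is their graft on \<open>T t0\<close>.
  \<open>R\<close> is the tree with the prefix \<open>node t0\<close> removed, since
  \<open>blow_up_tree\<close> asks for the root \<open>[]\<close>.\<close>

lemma staged_tree_aux:
  fixes m :: "'s \<Rightarrow> nat"
  assumes node: "\<And>t u. node (nxt t u) = node t @ u"
    and tree: "\<And>t. Inv t \<Longrightarrow> act t \<Longrightarrow> blow_up_tree (T t) \<and> finite (T t)"
    and step: "\<And>t u. \<lbrakk>Inv t; act t; u \<in> leaves (T t)\<rbrakk> \<Longrightarrow> Inv (nxt t u) \<and> m (nxt t u) < m t"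
  shows "Inv t0 \<Longrightarrow> \<exists>R. staged_tree act T nxt node t0 = (@) (node t0) ` R \<and> finite R \<and> blow_up_tree R \<and>
           (@) (node t0) ` leaves R = node ` {t \<in> reach act T nxt t0. \<not> act t}"
proof (induction "m t0" arbitrary: t0 rule: less_induct)
  case less
  show ?case
  proof (cases "act t0")
    case False
    have "leaves {[]} = ({[]} :: 'b tree)" by (auto simp: leaves_iff)
    moreover have "{t \<in> reach act T nxt t0. \<not> act t} = {t0}"
      using False by (auto simp: reach_inactive)
    ultimately show ?thesis
      using False by (intro exI[of _ "{[]}"]) (auto simp: staged_tree_def reach_inactive blow_up_tree_iff)
  next
    case True
    note T = tree[OF less.prems True]
    let ?Q = "\<lambda>s R. staged_tree act T nxt node s = (@) (node s) ` R \<and> finite R \<and> blow_up_tree R \<and>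
        (@) (node s) ` leaves R = node ` {t \<in> reach act T nxt s. \<not> act t}"
    have "\<forall>u \<in> leaves (T t0). \<exists>R. ?Q (nxt t0 u) R"
      using less.hyps step[OF less.prems True] by simp
    from bchoice[OF this] obtain R where R: "\<forall>u \<in> leaves (T t0). ?Q (nxt t0 u) (R u)" ..
    have "[] \<in> T t0" using T by (simp add: blow_up_tree_iff)
    then have "staged_tree act T nxt node t0 =
        (@) (node t0) ` T t0 \<union> (\<Union>u\<in>leaves (T t0). staged_tree act T nxt node (nxt t0 u))"
      by (rule staged_tree_active[where act = act, OF True])
    also have "\<dots> = (@) (node t0) ` T t0 \<union> (\<Union>u\<in>leaves (T t0). (@) (node t0 @ u) ` R u)"
      using R by (simp add: node)
    also have "\<dots> = (@) (node t0) ` graft (T t0) R"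
      by (simp add: graft_def image_Un image_UN image_image graft_set)
    finally have tree_eq: "staged_tree act T nxt node t0 = (@) (node t0) ` graft (T t0) R" .
    have "(@) (node t0) ` leaves (graft (T t0) R) = (\<Union>u\<in>leaves (T t0). (@) (node t0 @ u) ` leaves (R u))"
      using T R by (subst leaves_graft) (simp_all add: image_UN image_image graft_set)
    also have "\<dots> = (\<Union>u\<in>leaves (T t0). node ` {t \<in> reach act T nxt (nxt t0 u). \<not> act t})"
      using R by (simp add: node)
    also have "\<dots> = node ` {t \<in> reach act T nxt t0. \<not> act t}"
      unfolding reach_active[of act t0, OF True] using True by auto
    finally have leaves_eq:
      "(@) (node t0) ` leaves (graft (T t0) R) = node ` {t \<in> reach act T nxt t0. \<not> act t}" .
    show ?thesis
      using tree_eq leaves_eq T R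
      by (intro exI[of _ "graft (T t0) R"] conjI finite_graft blow_up_tree_graft) auto
  qed
qed

lemma staged_tree:
  fixes m :: "'s \<Rightarrow> nat"
  assumes "\<And>t u. node (nxt t u) = node t @ u"
    and "\<And>t. Inv t \<Longrightarrow> act t \<Longrightarrow> blow_up_tree (T t) \<and> finite (T t)"
    and "\<And>t u. \<lbrakk>Inv t; act t; u \<in> leaves (T t)\<rbrakk> \<Longrightarrow> Inv (nxt t u) \<and> m (nxt t u) < m t"
    and "Inv t0" "node t0 = []"
  shows finite_staged_tree: "finite (staged_tree act T nxt node t0)"
    and blow_up_tree_staged_tree: "blow_up_tree (staged_tree act T nxt node t0)"
    and leaves_staged_tree:
      "leaves (staged_tree act T nxt node t0) = node ` {t \<in> reach act T nxt t0. \<not> act t}"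
proof -
  have id: "(@) [] ` A = A" for A :: "'b tree" by force
  obtain R where R: "staged_tree act T nxt node t0 = R" "finite R" "blow_up_tree R"
      "leaves R = node ` {t \<in> reach act T nxt t0. \<not> act t}"
    using staged_tree_aux[of node nxt Inv act T m t0, OF assms(1,2,3,4)] unfolding assms(5) id by blast
  from R show "finite (staged_tree act T nxt node t0)" "blow_up_tree (staged_tree act T nxt node t0)"
    "leaves (staged_tree act T nxt node t0) = node ` {t \<in> reach act T nxt t0. \<not> act t}" by auto
qed

section \<open>Normal crossings and divisibility of monomials\<close>

lemma has_sum_monomial_shift:
  fixes q :: "nat ^ 'd" and w x :: "real ^ 'd"
  shows "((\<lambda>\<alpha>. (\<Prod>i\<in>UNIV. real (q $ i choose \<alpha> $ i) * (x $ i) ^ (q $ i - \<alpha> $ i)) * monomial \<alpha> (w - x))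
           has_sum monomial q w) UNIV"
proof -
  define B where "B = {\<alpha> :: nat ^ 'd. \<forall>i. \<alpha> $ i \<le> q $ i}"
  define G where "G = (PiE UNIV (\<lambda>i. {..q $ i}) :: ('d \<Rightarrow> nat) set)"
  let ?c = "\<lambda>\<alpha> :: nat ^ 'd. \<Prod>i\<in>UNIV. real (q $ i choose \<alpha> $ i) * (x $ i) ^ (q $ i - \<alpha> $ i)"
  have bij: "bij_betw vec_nth B G"
    by (rule bij_betw_byWitness[of _ vec_lambda]) (auto simp: B_def G_def PiE_def vec_nth_inverse)
  have "finite G" unfolding G_def by (intro finite_PiE) auto
  then have "finite B" using bij by (simp add: bij_betw_finite)
  have "monomial q w = (\<Prod>i\<in>UNIV. ((w - x) $ i + x $ i) ^ (q $ i))"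
    by (simp add: monomial_def)
  also have "\<dots> = (\<Prod>i\<in>UNIV. \<Sum>k\<le>q $ i. real (q $ i choose k) * ((w - x) $ i) ^ k * (x $ i) ^ (q $ i - k))"
    by (simp only: binomial_ring)
  also have "\<dots> = (\<Sum>g\<in>G. \<Prod>i\<in>UNIV. real (q $ i choose g i) * ((w - x) $ i) ^ (g i) * (x $ i) ^ (q $ i - g i))"
    unfolding G_def by (rule prod_sum_PiE) auto
  also have "\<dots> = (\<Sum>\<alpha>\<in>B. \<Prod>i\<in>UNIV. real (q $ i choose \<alpha> $ i) * ((w - x) $ i) ^ (\<alpha> $ i) * (x $ i) ^ (q $ i - \<alpha> $ i))"
    by (rule sum.reindex_bij_betw[OF bij, symmetric])
  also have "\<dots> = (\<Sum>\<alpha>\<in>B. ?c \<alpha> * monomial \<alpha> (w - x))"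
    unfolding monomial_def prod.distrib[symmetric] by (intro sum.cong prod.cong) (auto simp: ac_simps)
  finally have sum: "monomial q w = (\<Sum>\<alpha>\<in>B. ?c \<alpha> * monomial \<alpha> (w - x))" .
  \<comment> \<open>Outside the box one binomial coefficient vanishes, so the power series is the
    finite binomial expansion.\<close>
  have "?c \<alpha> = 0" if outside: "\<alpha> \<notin> B" for \<alpha>
  proof -
    obtain i where "q $ i < \<alpha> $ i" using outside by (auto simp: B_def not_le)
    then show ?thesis by (intro prod_zero) (auto intro!: bexI[of _ i])
  qed
  then show ?thesis
    by (intro has_sum_finite_neutralI[OF \<open>finite B\<close> _ _ sum]) auto
qed

lemma real_analytic_on_sop: "real_analytic_on (sop h) U"
proof -
  have "\<exists>c :: nat ^ 'a \<Rightarrow> real. \<forall>w. ((\<lambda>\<alpha>. c \<alpha> * monomial \<alpha> (w - x)) has_sum sop h w) UNIV" for x :: "real ^ 'a"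
  proof (induction h)
    case Nil
    show ?case by (rule exI[of _ "\<lambda>_. 0"]) (simp add: sop_def)
  next
    case (Cons q h)
    then obtain c where c: "\<And>w. ((\<lambda>\<alpha>. c \<alpha> * monomial \<alpha> (w - x)) has_sum sop h w) UNIV"
      by blast
    let ?b = "\<lambda>\<alpha>. \<Prod>i\<in>UNIV. real (q $ i choose \<alpha> $ i) * (x $ i) ^ (q $ i - \<alpha> $ i)"
    have "((\<lambda>\<alpha>. (?b \<alpha> + c \<alpha>) * monomial \<alpha> (w - x)) has_sum sop (q # h) w) UNIV" for w
      using has_sum_add[OF has_sum_monomial_shift[where q = q and x = x and w = w] c[of w]]
      by (simp add: sop_def distrib_right)
    then show ?case by (intro exI allI)
  qed
  \<comment> \<open>The expansion holds for all \<open>w\<close>, so radius 1 serves at every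
    centre.\<close>
  then show ?thesis
    unfolding real_analytic_on_def using zero_less_one by blast
qed

lemma monomial_nonneg: "(\<And>i. w $ i \<ge> 0) \<Longrightarrow> monomial a w \<ge> 0"
  by (simp add: monomial_def prod_nonneg)

lemma continuous_on_monomial [continuous_intros]: "continuous_on S (monomial a)"
  unfolding monomial_def by (intro continuous_intros)

text \<open>Unconditional convergence at one point \<open>x + y\<close> with all coordinates of
  \<open>y\<close> positive is absolute, and it dominates the series near \<open>x\<close>. By the
  Weierstrass test \<open>u\<close> is there a uniform limit of polynomials.\<close>

lemma real_analytic_on_imp_isCont:
  fixes u :: "real ^ 'd \<Rightarrow> real"
  assumes "real_analytic_on u U" "x \<in> U"
  shows "isCont u x"
proof -
  obtain r c where "r > 0" and c:
      "\<And>w. w \<in> ball x r \<Longrightarrow> ((\<lambda>\<alpha>. c \<alpha> * monomial \<alpha> (w - x)) has_sum u w) UNIV"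
    using assms unfolding real_analytic_on_def by blast
  \<comment> \<open>The sum of the coordinates of \<open>y\<close> is then \<open>r / 2\<close>,
    which bounds its norm.\<close>
  define \<rho> where "\<rho> = r / (2 * real CARD('d))"
  have "\<rho> > 0" using \<open>r > 0\<close> by (simp add: \<rho>_def)
  define y :: "real ^ 'd" where "y = (\<chi> i. \<rho>)"
  have "norm y \<le> (\<Sum>i\<in>UNIV. \<bar>y $ i\<bar>)" by (rule norm_le_l1_cart)
  also have "\<dots> < r" using \<open>r > 0\<close> \<open>\<rho> > 0\<close> by (simp add: y_def) (simp add: \<rho>_def)
  finally have "x + y \<in> ball x r" by (simp add: dist_norm)
  from c[OF this] have "(\<lambda>\<alpha>. c \<alpha> * monomial \<alpha> y) summable_on UNIV"
    by (auto simp: summable_on_def)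
  then have summable: "(\<lambda>\<alpha>. \<bar>c \<alpha> * monomial \<alpha> y\<bar>) summable_on UNIV"
    using summable_on_iff_abs_summable_on_real[of "\<lambda>\<alpha>. c \<alpha> * monomial \<alpha> y"] by simp
  define Y where "Y = ball x (min r \<rho>)"
  have bound: "norm (c \<alpha> * monomial \<alpha> (w - x)) \<le> \<bar>c \<alpha> * monomial \<alpha> y\<bar>" if "w \<in> Y" for \<alpha> w
  proof -
    have "\<bar>monomial \<alpha> (w - x)\<bar> \<le> \<bar>monomial \<alpha> y\<bar>"
      unfolding monomial_def abs_prod
    proof (intro prod_mono conjI)
      fix i
      have "\<bar>(w - x) $ i\<bar> \<le> norm (w - x)" by (rule component_le_norm_cart)
      also have "\<dots> \<le> \<rho>" using that by (simp add: Y_def dist_norm norm_minus_commute)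
      finally show "\<bar>(w - x) $ i ^ \<alpha> $ i\<bar> \<le> \<bar>y $ i ^ \<alpha> $ i\<bar>"
        using \<open>\<rho> > 0\<close> by (simp add: y_def power_abs power_mono del: vector_minus_component)
    qed simp
    then show ?thesis by (simp add: abs_mult mult_left_mono)
  qed
  have "uniform_limit Y (\<lambda>X w. \<Sum>\<alpha>\<in>X. c \<alpha> * monomial \<alpha> (w - x)) u (finite_subsets_at_top UNIV)"
    using bound by (rule Weierstrass_m_test_general') (auto simp: Y_def intro!: c summable)
  then have "continuous_on Y u"
    by (rule uniform_limit_theorem[rotated])
       (auto intro!: always_eventually continuous_intros
         continuous_on_compose2[OF continuous_on_monomial[of UNIV]])
  moreover have "open Y" "x \<in> Y" using \<open>r > 0\<close> \<open>\<rho> > 0\<close> by (auto simp: Y_def)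
  ultimately show ?thesis by (simp add: continuous_on_eq_continuous_at)
qed

section \<open>Incomparable exponents exclude a local normal crossing\<close>

lemma power_sum_factor_limit:
  fixes g :: "real \<Rightarrow> real"
  assumes lim: "(g \<longlongrightarrow> L) (at_right 0)" and "L \<noteq> 0"
    and eq: "\<forall>\<^sub>F t in at_right 0. t ^ p + t ^ q = g t * t ^ r"
  shows "L = (if p = q then 2 else 1)"
  using eq
proof (induction p q rule: linorder_wlog)
  case (sym p q)
  then show ?case by (simp add: add.commute split: if_splits)
next
  case (le p q)
  have pow: "((\<lambda>t::real. t ^ n) \<longlongrightarrow> (if n = 0 then 1 else 0)) (at_right 0)" for n
    by (auto intro!: tendsto_eq_intros)
  define c :: real where "c = (if p = q then 2 else 1)"
  have "((\<lambda>t::real. 1 + t ^ (q - p)) \<longlongrightarrow> 1 + (if q - p = 0 then 1 else 0)) (at_right 0)"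
    by (intro tendsto_intros pow)
  also have "1 + (if q - p = 0 then 1 else 0) = c" using le by (simp add: c_def)
  finally have lim1: "((\<lambda>t. 1 + t ^ (q - p)) \<longlongrightarrow> c) (at_right 0)" .
  have pos: "\<forall>\<^sub>F t in at_right 0. (0::real) < t" by (rule eventually_at_right_less)
  have uniq: "a = b" if "(f \<longlongrightarrow> a) (at_right 0)" "(h \<longlongrightarrow> b) (at_right 0)"
      "\<forall>\<^sub>F t in at_right 0. f t = h t" for f h :: "real \<Rightarrow> real" and a b
    using that tendsto_unique[OF _ that(1)] tendsto_cong[OF that(3)] by auto
  \<comment> \<open>Cancelling the smaller of \<open>t ^ p\<close> and \<open>t ^ r\<close> leaves
    \<open>r = p\<close> as the only possibility: for \<open>p < r\<close> the right side tends to 0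
    while \<open>c\<close> is positive, and for \<open>r < p\<close> the limit \<open>L\<close>
    would be 0.\<close>
  show ?case
  proof (cases "p \<le> r")
    case True
    have "\<forall>\<^sub>F t in at_right 0. 1 + t ^ (q - p) = g t * t ^ (r - p)"
      using le(2) pos
    proof eventually_elim
      case (elim t)
      have "t ^ p * (1 + t ^ (q - p)) = t ^ p * (g t * t ^ (r - p))"
        using elim le(1) True by (simp add: algebra_simps flip: power_add)
      then show ?case using elim by simp
    qed
    from uniq[OF lim1 tendsto_mult[OF lim pow] this] show ?thesis
      by (auto simp: c_def split: if_splits)
  next
    case False
    have "\<forall>\<^sub>F t in at_right 0. t ^ (p - r) * (1 + t ^ (q - p)) = g t"
      using le(2) pos
    proof eventually_elim
      case (elim t)
      have "t ^ r * (t ^ (p - r) * (1 + t ^ (q - p))) = t ^ r * g t"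
        using elim le(1) False by (simp add: algebra_simps flip: power_add)
      then show ?case using elim by simp
    qed
    from uniq[OF tendsto_mult[OF pow lim1] lim this] show ?thesis
      using False \<open>L \<noteq> 0\<close> by simp
  qed
qed

lemma monomial_curve: "monomial a (\<chi> l. t ^ v l) = t ^ (\<Sum>l\<in>UNIV. a $ l * v l)"
  by (simp add: monomial_def power_sum mult.commute flip: power_mult)

lemma sop_pair: "sop [a, b] w = monomial a w + monomial b w"
  by (simp add: sop_def)

text \<open>Take the weight \<open>D = b $ j - a $ j\<close> everywhere and add the difference
  \<open>s\<close> of the total degrees at \<open>j\<close>. The weighted degrees then differ by
  \<open>s * D - D * s = 0\<close>.\<close>

lemma exists_balanced_weights:
  fixes a b :: "nat ^ 'd"
  assumes "a $ j < b $ j" and "(\<Sum>l\<in>UNIV. b $ l) \<le> (\<Sum>l\<in>UNIV. a $ l)"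
  shows "\<exists>v. (\<forall>l. v l > 0) \<and> (\<Sum>l\<in>UNIV. a $ l * v l) = (\<Sum>l\<in>UNIV. b $ l * v l)"
proof -
  obtain D where D: "b $ j = a $ j + D" "D > 0"
    using assms(1) less_imp_add_positive by metis
  obtain s where s: "(\<Sum>l\<in>UNIV. a $ l) = (\<Sum>l\<in>UNIV. b $ l) + s"
    using assms(2) le_Suc_ex by blast
  have "(\<Sum>l\<in>UNIV. c $ l * (D + (if l = j then s else 0))) = (\<Sum>l\<in>UNIV. c $ l) * D + c $ j * s"
    for c :: "nat ^ 'd"
  proof -
    have "c $ l * (D + (if l = j then s else 0)) = c $ l * D + (if l = j then c $ j * s else 0)" for l
      by (simp add: algebra_simps)
    then show ?thesis by (simp add: sum.distrib sum_distrib_right)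
  qed
  then show ?thesis
    using D s by (intro exI[of _ "\<lambda>l. D + (if l = j then s else 0)"]) (simp add: algebra_simps)
qed

text \<open>
  Along the curves \<open>t \<mapsto> t\<^sup>v\<close>, \<open>v > 0\<close>, the unit \<open>u\<close> tends to 1 or 2, the value 2 occurring
  exactly if \<open>a \<bullet> v = b \<bullet> v\<close>.  For incomparable \<open>a\<close> and \<open>b\<close> both kinds of \<open>v\<close> exist.
\<close>

lemma local_normal_crossing_pair_imp_comparable:
  fixes a b :: "nat ^ 'd"
  assumes "local_normal_crossing (sop [a, b])"
  shows "a \<le> b \<or> b \<le> a"
proof (rule ccontr)
  assume "\<not> (a \<le> b \<or> b \<le> a)"
  then obtain i j where ij: "b $ i < a $ i" "a $ j < b $ j"
    by (auto simp: less_eq_vec_def not_le)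
  obtain u k U where U: "open U" "0 \<in> U" "real_analytic_on u U" and u: "\<And>w. w \<in> U \<Longrightarrow> u w \<noteq> 0"
      and F: "\<And>w. w \<in> U \<Longrightarrow> sop [a, b] w = u w * monomial k w"
    using assms unfolding local_normal_crossing_def by blast
  have cont: "isCont u 0" using U by (blast intro: real_analytic_on_imp_isCont)
  have u0: "u 0 = (if (\<Sum>l\<in>UNIV. a $ l * v l) = (\<Sum>l\<in>UNIV. b $ l * v l) then 2 else 1)"
    if v: "\<And>l. v l > 0" for v :: "'d \<Rightarrow> nat"
  proof (rule power_sum_factor_limit)
    let ?\<gamma> = "\<lambda>t::real. (\<chi> l. t ^ v l) :: real ^ 'd"
    have "((\<lambda>t. \<chi> l. t ^ v l) \<longlongrightarrow> (\<chi> l. (0 :: real) ^ v l)) (at_right 0)"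
      by (intro tendsto_intros)
    also have "(\<chi> l. (0 :: real) ^ v l) = 0" using v by (simp add: vec_eq_iff)
    finally have \<gamma>: "(?\<gamma> \<longlongrightarrow> 0) (at_right 0)" .
    show "((\<lambda>t. u (?\<gamma> t)) \<longlongrightarrow> u 0) (at_right 0)"
      using isCont_tendsto_compose[OF cont \<gamma>] .
    show "u 0 \<noteq> 0" using u U by blast
    have "\<forall>\<^sub>F t in at_right 0. ?\<gamma> t \<in> U"
      using topological_tendstoD[OF \<gamma> U(1,2)] .
    then show "\<forall>\<^sub>F t in at_right 0. t ^ (\<Sum>l\<in>UNIV. a $ l * v l) + t ^ (\<Sum>l\<in>UNIV. b $ l * v l)
        = u (?\<gamma> t) * t ^ (\<Sum>l\<in>UNIV. k $ l * v l)"
      by eventually_elim (use F in \<open>simp add: sop_pair flip: monomial_curve\<close>)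
  qed
  \<comment> \<open>The extra weight goes to \<open>j\<close> or to \<open>i\<close>, depending on
    which total degree is larger.\<close>
  have "\<exists>v. (\<forall>l. v l > 0) \<and> (\<Sum>l\<in>UNIV. a $ l * v l) = (\<Sum>l\<in>UNIV. b $ l * v l)"
    using exists_balanced_weights[OF ij(2)] exists_balanced_weights[OF ij(1)] by (metis linear)
  then obtain v where v: "\<And>l. v l > 0" "(\<Sum>l\<in>UNIV. a $ l * v l) = (\<Sum>l\<in>UNIV. b $ l * v l)"
    by blast
  have "u 0 = 2" using u0[of v] v by simp
  \<comment> \<open>Raising the weight of \<open>i\<close> by one destroys the balance, because
    \<open>a\<close> and \<open>b\<close> differ at \<open>i\<close>.\<close>
  have "(\<Sum>l\<in>UNIV. c $ l * (if l = i then v l + 1 else v l)) = (\<Sum>l\<in>UNIV. c $ l * v l) + c $ i"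
    for c :: "nat ^ 'd"
  proof -
    have "(\<Sum>l\<in>UNIV. c $ l * (if l = i then v l + 1 else v l)) = (\<Sum>l\<in>UNIV. c $ l * v l + (if l = i then c $ i else 0))"
      by (intro sum.cong) auto
    then show ?thesis by (simp add: sum.distrib)
  qed
  then have "u 0 = 1" using u0[of "\<lambda>l. if l = i then v l + 1 else v l"] v ij by auto
  with \<open>u 0 = 2\<close> show False by simp
qed

lemma normal_crossing_imp_local: "normal_crossing F \<Longrightarrow> local_normal_crossing F"
  unfolding normal_crossing_def local_normal_crossing_def
  by (metis UNIV_I less_irrefl open_UNIV)

section \<open>Divisibility gives normal crossings\<close>

lemma monomial_add: "monomial (a + b) w = monomial a w * monomial b w"
  by (simp add: monomial_def power_add prod.distrib)

lemma sop_factor: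
  assumes "\<forall>b \<in> set h. a \<le> b"
  shows "sop h w = sop (map (\<lambda>b. b - a) h) w * monomial a w"
proof -
  have "b - a + a = b" if "b \<in> set h" for b
    using assms that by (auto simp: vec_eq_iff less_eq_vec_def)
  then have "monomial b w = monomial (b - a) w * monomial a w" if "b \<in> set h" for b
    using that by (metis monomial_add)
  then have "(\<Sum>b\<leftarrow>h. monomial b w) = (\<Sum>b\<leftarrow>h. monomial (b - a) w * monomial a w)"
    by (metis (mono_tags, lifting) map_eq_conv)
  then show ?thesis by (simp add: sop_def sum_list_mult_const o_def)
qed

text \<open>After division by the term \<open>a\<close>, this term becomes the constant 1 and the
  others are non-negative at the origin. The quotient is thus positive near the origin.\<close>

lemma local_normal_crossing_sop:
  fixes h :: "(nat ^ 'd) list"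
  assumes a: "a \<in> set h" and le: "\<forall>b \<in> set h. a \<le> b"
  shows "local_normal_crossing (sop h)"
proof -
  let ?q = "map (\<lambda>b. b - a) h"
  let ?U = "{w. 0 < sop ?q w}"
  have "monomial (0 :: nat ^ 'd) 0 = 1" by (simp add: monomial_def)
  then have "1 \<le> sop ?q 0"
    using a by (auto simp: sop_def in_set_conv_decomp intro!: add_increasing add_increasing2
        sum_list_nonneg monomial_nonneg)
  have "continuous_on UNIV (sop ?q)"
    using real_analytic_on_sop[of ?q UNIV]
    by (intro continuous_at_imp_continuous_on) (auto intro: real_analytic_on_imp_isCont)
  then have "open ?U" by (intro open_Collect_less continuous_intros)
  show ?thesis
    unfolding local_normal_crossing_def
    using \<open>open ?U\<close> \<open>1 \<le> sop ?q 0\<close> sop_factor[OF le]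
    by (intro exI[of _ "sop ?q"] exI[of _ a] exI[of _ ?U]) (auto simp: real_analytic_on_sop)
qed

text \<open>The quotient is 1 plus a monomial with even exponents, hence positive
  everywhere.\<close>

lemma normal_crossing_even_pair:
  fixes a b :: "nat ^ 'd"
  assumes "a \<le> b" "\<forall>l. even (a $ l)" "\<forall>l. even (b $ l)"
  shows "normal_crossing (sop [a, b])"
proof -
  have q: "sop [a - a, b - a] w = 1 + monomial (b - a) w" for w
    by (simp add: sop_def monomial_def)
  have "0 < sop [a - a, b - a] w" for w
    unfolding q using assms
    by (auto simp: monomial_def intro!: add_pos_nonneg prod_nonneg zero_le_even_power)
  then show ?thesis
    unfolding normal_crossing_def
    using sop_factor[of "[a, b]" a] assms(1) real_analytic_on_sop[of "[a - a, b - a]" UNIV]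
    by (intro exI[of _ "sop [a - a, b - a]"] exI[of _ a]) auto
qed

lemma sop_pair_commute: "sop [a, b] = sop [b, a]"
  by (simp add: fun_eq_iff sop_def)

lemma normal_crossing_even_pair_iff:
  fixes a b :: "nat ^ 'd"
  assumes "\<forall>l. even (a $ l)" "\<forall>l. even (b $ l)"
  shows "normal_crossing (sop [a, b]) \<longleftrightarrow> a \<le> b \<or> b \<le> a"
  using assms normal_crossing_even_pair[of a b] normal_crossing_even_pair[of b a]
    local_normal_crossing_pair_imp_comparable[of a b] normal_crossing_imp_local
  by (auto simp: sop_pair_commute[of b a])

lemma local_normal_crossing_pair_iff:
  fixes a b :: "nat ^ 'd"
  shows "local_normal_crossing (sop [a, b]) \<longleftrightarrow> a \<le> b \<or> b \<le> a"
  using local_normal_crossing_sop[of a "[a, b]"] local_normal_crossing_sop[of b "[a, b]"]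
    local_normal_crossing_pair_imp_comparable[of a b] by auto

lemma nonneg_pair_imp_even_fst:
  fixes a b :: "nat ^ 'd"
  assumes "a \<noteq> b" and nonneg: "\<And>w. sop [a, b] w \<ge> 0"
  shows "even (a $ i)"
proof (rule ccontr)
  assume odd: "odd (a $ i)"
  obtain l where l: "a $ l \<noteq> b $ l" using \<open>a \<noteq> b\<close> by (auto simp: vec_eq_iff)
  \<comment> \<open>With modulus \<open>T\<close> in coordinate \<open>l\<close> the term of
    \<open>a\<close> outweighs that of \<open>b\<close>; a sign change in coordinate
    \<open>i\<close>, which may equal \<open>l\<close>, makes it negative.\<close>
  define T :: real where "T = (if b $ l < a $ l then 2 else 1 / 2)"
  have T: "T > 0" "T ^ (b $ l) < T ^ (a $ l)"
    using l by (auto simp: T_def power_strict_increasing power_strict_decreasing)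
  define w :: "real ^ 'd" where "w = (\<chi> k. (if k = i then -1 else 1) * (if k = l then T else 1))"
  have mon: "monomial c w = (- 1) ^ (c $ i) * T ^ (c $ l)" for c
  proof -
    have "(w $ k) ^ (c $ k) = (if k = i then (- 1) ^ (c $ i) else 1) * (if k = l then T ^ (c $ l) else 1)" for k
      by (simp add: w_def power_mult_distrib)
    then show ?thesis by (simp add: monomial_def prod.distrib)
  qed
  have "(- 1) ^ (b $ i) * T ^ (b $ l) \<le> T ^ (b $ l)"
    using T(1) by (cases "even (b $ i)") auto
  also note T(2)
  finally have "sop [a, b] w < 0"
    using odd by (simp add: sop_pair mon)
  with nonneg[of w] show False by simp
qed

lemma SP_nonneg_2_even:
  assumes "[a, b] \<in> SP_nonneg 2"
  shows "\<forall>l. even (a $ l)" "\<forall>l. even (b $ l)"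
  using assms nonneg_pair_imp_even_fst[of a b] nonneg_pair_imp_even_fst[of b a]
  by (auto simp: SP_nonneg_def SP_def sop_pair_commute[of b a])

section \<open>Exponents along a branch\<close>

lemma poly_at_eq: "poly_at x v = map (fold subst_exp v) (fst x)"
  by (induction v rule: rev_induct) (auto simp: pair_at_def blow_up_def)

text \<open>Divisibility survives all later blow-ups, so Algorithm C keeps what its earlier stages
  achieved.\<close>

lemma fold_subst_exp_mono:
  fixes a b :: "nat ^ 'd"
  shows "a \<le> b \<Longrightarrow> fold subst_exp v a \<le> fold subst_exp v b"
proof (induction v arbitrary: a b)
  case (Cons e v)
  have "subst_exp e a \<le> subst_exp e b"
    using Cons.prems by (auto simp: subst_exp_def less_eq_vec_def intro: add_mono)
  then show ?case using Cons.IH by simp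
qed simp

lemma subst_exp_nth:
  "i \<noteq> j \<Longrightarrow> subst_exp (i, j) a $ i = a $ i"
  "subst_exp (i, j) a $ j = a $ i + a $ j"
  "l \<noteq> j \<Longrightarrow> subst_exp (i, j) a $ l = a $ l"
  by (simp_all add: subst_exp_def)

section \<open>Blow-up between variables\<close>

text \<open>Treats both stopping tests at once: normal crossings with \<open>P\<close> saying that
  all exponents are even, and local normal crossings with \<open>P\<close> always true. The closure
  properties keep \<open>P\<close> along a branch and after restriction to two variables.\<close>

locale binomial_test =
  fixes N :: "(real ^ 'd \<Rightarrow> real) \<Rightarrow> bool" and P :: "nat ^ 'd \<Rightarrow> bool"
  assumes P_subst: "P a \<Longrightarrow> P (subst_exp e a)"
    and P_restrict: "P a \<Longrightarrow> P (restrict_vars S a)"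
    and N_iff: "P a \<Longrightarrow> P b \<Longrightarrow> N (sop [a, b]) \<longleftrightarrow> a \<le> b \<or> b \<le> a"
begin

lemma P_fold: "P a \<Longrightarrow> P (fold subst_exp v a)"
  by (induction v arbitrary: a) (auto intro: P_subst)

end

definition comparable_in :: "'d \<Rightarrow> 'd \<Rightarrow> nat ^ 'd \<Rightarrow> nat ^ 'd \<Rightarrow> bool" where
  "comparable_in i j a b \<longleftrightarrow> a $ i \<le> b $ i \<and> a $ j \<le> b $ j \<or> b $ i \<le> a $ i \<and> b $ j \<le> a $ j"

lemma blow_up_tree_single:
  assumes "i \<noteq> j"
  shows "blow_up_tree {[], [(i, j)], [(j, i)]}"
  unfolding blow_up_tree_iff using assms by auto

lemma leaves_single: "leaves {[], [(i, j)], [(j, i)]} = {[(i, j)], [(j, i)]}"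
  by (auto simp: leaves_iff) blast

lemma alg_A_eq_reach:
  "alg_A N i j x = reach (\<lambda>v. \<not> N (sop (map (restrict_vars {i, j}) (poly_at x v))))
     (\<lambda>_. {[], [(i, j)], [(j, i)]}) (@) []"
  (is "_ = reach ?act ?T _ _")
proof (intro equalityI subsetI)
  fix v assume "v \<in> alg_A N i j x"
  then show "v \<in> reach ?act ?T (@) []"
  proof induction
    case (child v e)
    then show ?case
      using reach.step[of v ?act ?T "(@)" "[]" "[e]"] by (simp add: leaves_single)
  qed (rule reach.root)
next
  fix v assume "v \<in> reach ?act ?T (@) []"
  then show "v \<in> alg_A N i j x"
    by induction (auto simp: leaves_single intro: alg_A.intros)
qed

lemma alg_A_eq_staged_tree:
  "alg_A N i j x = staged_tree (\<lambda>v. \<not> N (sop (map (restrict_vars {i, j}) (poly_at x v))))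
     (\<lambda>_. {[], [(i, j)], [(j, i)]}) (@) (\<lambda>v. v) []"
  unfolding staged_tree_def alg_A_eq_reach[symmetric] by (auto intro: alg_A.child)

context binomial_test
begin

context
  fixes i j :: 'd and x :: "'d pair" and a b :: "nat ^ 'd"
  assumes ij: "i \<noteq> j" and x: "fst x = [a, b]" and P: "P a" "P b"
begin

text \<open>The restricted vectors vanish outside \<open>i\<close> and \<open>j\<close>, so only
  these coordinates are compared.\<close>

lemma alg_A_test:
  "N (sop (map (restrict_vars {i, j}) (poly_at x v))) \<longleftrightarrow>
     comparable_in i j (fold subst_exp v a) (fold subst_exp v b)"
  using N_iff[OF P_restrict P_restrict, OF P_fold P_fold, OF P, of "{i, j}" v "{i, j}" v] ij
  by (auto simp: poly_at_eq x less_eq_vec_def restrict_vars_def comparable_in_def)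

lemma alg_A_tree:
  shows finite_alg_A: "finite (alg_A N i j x)"
    and blow_up_tree_alg_A: "blow_up_tree (alg_A N i j x)"
    and leaves_alg_A: "leaves (alg_A N i j x) =
      {v \<in> alg_A N i j x. comparable_in i j (fold subst_exp v a) (fold subst_exp v b)}"
proof -
  let ?act = "\<lambda>v. \<not> N (sop (map (restrict_vars {i, j}) (poly_at x v)))"
  let ?T = "\<lambda>_ :: 'd chart list. {[], [(i, j)], [(j, i)]}"
  \<comment> \<open>While the signs stay opposite, one modulus shrinks by the other. The value 0
    covers the step at which they stop being opposite, where the sum may grow: (3, -1) becomes (3,
    2).\<close>
  let ?m = "\<lambda>v. let A = fold subst_exp v a; B = fold subst_exp v b in
    if comparable_in i j A B then 0
    else nat (\<bar>int (A $ i) - int (B $ i)\<bar> + \<bar>int (A $ j) - int (B $ j)\<bar>)"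
  have step: "?m (v @ u) < ?m v" if "?act v" and "u \<in> leaves (?T v)" for v u
  proof -
    have "\<not> comparable_in i j (fold subst_exp v a) (fold subst_exp v b)"
      using that alg_A_test by blast
    moreover have "u = [(i, j)] \<or> u = [(j, i)]" using that(2) by (simp add: leaves_single)
    ultimately show ?thesis
      using ij unfolding comparable_in_def Let_def
      by (elim disjE) (auto simp: subst_exp_nth)
  qed
  note tree = staged_tree[where node = "\<lambda>v. v" and Inv = "\<lambda>_. True" and m = ?m and act = ?act
      and T = ?T and nxt = "(@)" and ?t0.0 = "[]", folded alg_A_eq_staged_tree alg_A_eq_reach]
  show "finite (alg_A N i j x)" "blow_up_tree (alg_A N i j x)"
    by (rule tree; use blow_up_tree_single[OF ij] step in simp)+
  have "leaves (alg_A N i j x) = (\<lambda>v. v) ` {v \<in> alg_A N i j x. \<not> ?act v}"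
    by (rule tree; use blow_up_tree_single[OF ij] step in simp)
  then show "leaves (alg_A N i j x) =
      {v \<in> alg_A N i j x. comparable_in i j (fold subst_exp v a) (fold subst_exp v b)}"
    by (simp add: alg_A_test)
qed

text \<open>With \<open>p\<close> and \<open>-q\<close> the entries of \<delta> at \<open>i\<close>
  and \<open>j\<close>, the alternatives are: neither has left its side, \<open>j\<close> has, or
  \<open>i\<close> has. An entry that crosses over is the difference of two positive numbers, hence
  smaller than the entry that stayed; this strict bound is what the measure needs.\<close>

lemma alg_A_exponents:
  assumes start: "b $ i < a $ i" "a $ j < b $ j" and v: "v \<in> alg_A N i j x"
  defines "p \<equiv> int (fold subst_exp v a $ i) - int (fold subst_exp v b $ i)"
    and "q \<equiv> int (fold subst_exp v b $ j) - int (fold subst_exp v a $ j)"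
  shows "(\<forall>l. l \<noteq> i \<longrightarrow> l \<noteq> j \<longrightarrow> fold subst_exp v a $ l = a $ l \<and> fold subst_exp v b $ l = b $ l) \<and>
    (0 < p \<and> p \<le> int (a $ i) - int (b $ i) \<and> 0 < q \<and> q \<le> int (b $ j) - int (a $ j) \<or>
     q \<le> 0 \<and> - q < p \<and> p \<le> int (a $ i) - int (b $ i) \<or>
     p \<le> 0 \<and> - p < q \<and> q \<le> int (b $ j) - int (a $ j))"
  using v unfolding p_def q_def
proof induction
  case root
  then show ?case using start by auto
next
  case (child v e)
  have "\<not> comparable_in i j (fold subst_exp v a) (fold subst_exp v b)"
    using child.hyps alg_A_test by blast
  moreover have "e = (i, j) \<or> e = (j, i)" using child.hyps by simp
  \<comment> \<open>A node with a child is incomparable in \<open>i\<close> and \<open>j\<close>, so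
    only the first alternative holds before the step.\<close>
  ultimately show ?case
    using child.IH ij unfolding comparable_in_def
    by (elim disjE) (auto simp: subst_exp_nth)
qed

end

end

section \<open>Blow-up between terms\<close>

text \<open>
  Encodes the lexicographic order on (maximum, number of times it is attained); the subtractions in
  \<open>gap_measure\<close> are truncated and give the positive and the negative part of \<open>a - b\<close>.
\<close>

definition max_potential :: "('d::finite \<Rightarrow> nat) \<Rightarrow> nat" where
  "max_potential D = Max (range D) * (CARD('d) + 1) + card {l. D l = Max (range D)}"

lemma max_potential_less_of_Max_less:
  fixes D D' :: "'d::finite \<Rightarrow> nat"
  assumes "Max (range D') < Max (range D)"
  shows "max_potential D' < max_potential D"
proof -
  \<comment> \<open>The number of maximal positions is at most \<open>CARD('d)\<close>, below the
    radix, so it cannot offset a change of the maximum.\<close>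
  have "max_potential D' \<le> Max (range D') * (CARD('d) + 1) + CARD('d)"
    unfolding max_potential_def by (intro add_left_mono card_mono) auto
  also have "\<dots> < Suc (Max (range D')) * (CARD('d) + 1)"
    by simp
  also have "\<dots> \<le> Max (range D) * (CARD('d) + 1)"
    using Suc_leI[OF assms] by (intro mult_right_mono) auto
  finally show ?thesis unfolding max_potential_def by simp
qed

lemma Max_range_eqI: "(\<And>l. D l \<le> D i) \<Longrightarrow> Max (range D) = (D i :: nat)" for D :: "'d::finite \<Rightarrow> nat"
  by (rule Max_eqI) auto

text \<open>Either the maximum drops, or it stays and \<open>j\<close> leaves the set of positions
  that attain it.\<close>

lemma max_potential_less:
  fixes D D' :: "'d::finite \<Rightarrow> nat"
  assumes le: "\<And>l. D' l \<le> D l" and max: "\<And>l. D l \<le> D j" and less: "D' j < D j"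
  shows "max_potential D' < max_potential D"
proof -
  have D: "Max (range D) = D j" using max by (rule Max_range_eqI)
  have "Max (range D') \<le> D j"
    using le max by (auto intro: order_trans)
  then consider "Max (range D') < Max (range D)" | "Max (range D') = D j"
    unfolding D by linarith
  then show ?thesis
  proof cases
    case 2
    have "l \<in> {l. D l = D j}" if "D' l = D j" for l
      using that le[of l] max[of l] by simp
    moreover have "j \<in> {l. D l = D j}" "j \<notin> {l. D' l = D j}" using less by auto
    ultimately have "{l. D' l = D j} \<subset> {l. D l = D j}" by blast
    then have "card {l. D' l = D j} < card {l. D l = D j}" by (intro psubset_card_mono) auto
    then show ?thesis unfolding max_potential_def D 2 by simp
  qed (rule max_potential_less_of_Max_less)
qed

text \<open>Entries off \<open>i\<close> may grow as long as they stay below the old maximum; this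
  is the situation on the side that receives a crossing variable.\<close>

lemma max_potential_le:
  fixes D D' :: "'d::finite \<Rightarrow> nat"
  assumes other: "\<And>l. l \<noteq> i \<Longrightarrow> D' l = D l \<or> D' l < D i" and le: "D' i \<le> D i" and max: "\<And>l. D l \<le> D i"
  shows "max_potential D' \<le> max_potential D"
proof -
  have D: "Max (range D) = D i" using max by (rule Max_range_eqI)
  have "D' l \<le> D i" for l
    using other[of l] le max[of l] by (cases "l = i") auto
  then have "Max (range D') \<le> D i" by auto
  then consider "Max (range D') < Max (range D)" | "Max (range D') = D i"
    unfolding D by linarith
  then show ?thesis
  proof cases
    case 1
    then show ?thesis by (intro less_imp_le max_potential_less_of_Max_less)
  next
    case 2
    have "{l. D' l = D i} \<subseteq> {l. D l = D i}" using other by fastforce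
    then have "card {l. D' l = D i} \<le> card {l. D l = D i}" by (intro card_mono) auto
    then show ?thesis unfolding max_potential_def D 2 by simp
  qed
qed

definition gap_measure :: "nat ^ 'd \<Rightarrow> nat ^ 'd \<Rightarrow> nat" where
  "gap_measure a b = max_potential (\<lambda>l. a $ l - b $ l) + max_potential (\<lambda>l. b $ l - a $ l)"

lemma gap_measure_commute: "gap_measure a b = gap_measure b a"
  by (simp add: gap_measure_def)

text \<open>The case in which \<open>j\<close> has crossed over. On the side of \<open>a\<close> its
  new entry is below the old maximum at \<open>i\<close>; on the side of \<open>b\<close> a maximal
  entry drops to 0, and \<open>i\<close> contributes nothing there because it has kept its
  sign.\<close>

lemma gap_measure_less:
  fixes a b A B :: "nat ^ 'd"
  assumes max_i: "\<And>l. a $ l - b $ l \<le> a $ i - b $ i" and max_j: "\<And>l. b $ l - a $ l \<le> b $ j - a $ j"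
    and ij: "i \<noteq> j" and other: "\<And>l. l \<noteq> i \<Longrightarrow> l \<noteq> j \<Longrightarrow> A $ l = a $ l \<and> B $ l = b $ l"
    and j: "B $ j \<le> A $ j" "a $ j < b $ j" "A $ j - B $ j < A $ i - B $ i"
    and i: "A $ i - B $ i \<le> a $ i - b $ i"
  shows "gap_measure A B < gap_measure a b"
proof -
  have "max_potential (\<lambda>l. A $ l - B $ l) \<le> max_potential (\<lambda>l. a $ l - b $ l)"
  proof (rule max_potential_le[of i])
    show "A $ l - B $ l = a $ l - b $ l \<or> A $ l - B $ l < a $ i - b $ i" if "l \<noteq> i" for l
      using that other[of l] j i by (cases "l = j") auto
  qed (use max_i i in auto)
  moreover have "max_potential (\<lambda>l. B $ l - A $ l) < max_potential (\<lambda>l. b $ l - a $ l)"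
  proof (rule max_potential_less[of _ _ j])
    show "B $ l - A $ l \<le> b $ l - a $ l" for l
      using other[of l] j by (cases "l = i"; cases "l = j") auto
  qed (use max_j j in auto)
  ultimately show ?thesis unfolding gap_measure_def by linarith
qed

text \<open>Since \<open>p1\<close> and \<open>p2\<close> are coprime, they are the truncated
  differences of \<open>a\<close> and \<open>b\<close>; incomparability makes both non-zero, so
  their maximal entries are positive.\<close>

lemma max_degree_vars_pair:
  fixes a b :: "nat ^ 'd"
  assumes "max_degree_vars [a, b] s" and "\<not> (a \<le> b \<or> b \<le> a)"
  shows "b $ fst s < a $ fst s" "a $ snd s < b $ snd s"
    "a $ l - b $ l \<le> a $ fst s - b $ fst s" "b $ l - a $ l \<le> b $ snd s - a $ snd s"
proof -
  obtain c p1 p2 where ab: "a = c + p1" "b = c + p2" and coprime: "\<And>i. p1 $ i = 0 \<or> p2 $ i = 0"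
      and max: "\<And>i. p1 $ i \<le> p1 $ fst s" "\<And>i. p2 $ i \<le> p2 $ snd s"
    using assms(1) unfolding max_degree_vars_def by auto
  have diff: "a $ l - b $ l = p1 $ l" "b $ l - a $ l = p2 $ l" for l
    using coprime[of l] by (auto simp: ab)
  then show "a $ l - b $ l \<le> a $ fst s - b $ fst s" "b $ l - a $ l \<le> b $ snd s - a $ snd s" for l
    using max by auto
  obtain i j where "b $ i < a $ i" "a $ j < b $ j"
    using assms(2) by (auto simp: less_eq_vec_def not_le)
  then have "0 < p1 $ i" "0 < p2 $ j" by (simp_all flip: diff)
  then have "0 < p1 $ fst s" "0 < p2 $ snd s"
    using max(1)[of i] max(2)[of j] by linarith+
  then show "b $ fst s < a $ fst s" "a $ snd s < b $ snd s" by (simp_all flip: diff)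
qed

lemma exists_max_degree_vars:
  fixes h :: "(nat ^ 'd) list"
  assumes "length h = 2"
  shows "\<exists>s. max_degree_vars h s"
proof -
  obtain a b where h: "h = [a, b]"
    using assms by (auto simp: numeral_2_eq_2 length_Suc_conv)
  have "\<exists>i. \<forall>l. p $ l \<le> p $ i" for p :: "nat ^ 'd"
    using Max_in[of "range (($) p)"] Max_ge[of "range (($) p)"] by fastforce
  then obtain i j where "\<forall>l. (a - b) $ l \<le> (a - b) $ i" "\<forall>l. (b - a) $ l \<le> (b - a) $ j"
    by meson
  then show ?thesis
    \<comment> \<open>The common factor is the componentwise minimum, and the cofactors are the
      truncated differences.\<close>
    unfolding max_degree_vars_def h
    by (intro exI[of _ "(i, j)"] exI[of _ "\<chi> l. min (a $ l) (b $ l)"] exI[of _ "a - b"] exI[of _ "b - a"])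
       (auto simp: vec_eq_iff)
qed

lemma exists_alg_B:
  assumes "length (fst x) = 2"
  shows "\<exists>V. alg_B N x V"
proof -
  have "max_degree_vars (poly_at x v) (SOME s. max_degree_vars (poly_at x v) s)" for v
    using exists_max_degree_vars[of "poly_at x v"] assms by (simp add: poly_at_eq someI_ex)
  then show ?thesis
    unfolding alg_B_def by (intro exI[of _ "\<lambda>v. SOME s. max_degree_vars (poly_at x v) s"] exI conjI) auto
qed

context binomial_test
begin

text \<open>At a leaf one of the two variables has left its side. The two cases are exchanged by
  swapping \<open>a\<close> with \<open>b\<close> and \<open>i\<close> with
  \<open>j\<close>.\<close>

lemma gap_measure_leaf_alg_A:
  assumes "\<not> (a \<le> b \<or> b \<le> a)" "max_degree_vars [a, b] s" "fst x = [a, b]" "P a" "P b"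
    and v: "v \<in> leaves (alg_A N (fst s) (snd s) x)"
  shows "gap_measure (fold subst_exp v a) (fold subst_exp v b) < gap_measure a b"
proof -
  obtain i j where s: "s = (i, j)" by fastforce
  note max = max_degree_vars_pair[OF assms(2,1), unfolded s fst_conv snd_conv]
  let ?A = "fold subst_exp v a" and ?B = "fold subst_exp v b"
  have ij: "i \<noteq> j" using max by auto
  have "v \<in> alg_A N i j x" and comparable: "comparable_in i j ?A ?B"
    using v leaves_alg_A[OF ij assms(3-5)] by (simp_all add: s)
  from alg_A_exponents[OF ij assms(3-5) max(1,2) this(1)]
  have other: "\<And>l. l \<noteq> i \<Longrightarrow> l \<noteq> j \<Longrightarrow> ?A $ l = a $ l \<and> ?B $ l = b $ l"
    and "?B $ j \<le> ?A $ j \<and> ?A $ j - ?B $ j < ?A $ i - ?B $ i \<and> ?A $ i - ?B $ i \<le> a $ i - b $ i \<or>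
      ?A $ i \<le> ?B $ i \<and> ?B $ i - ?A $ i < ?B $ j - ?A $ j \<and> ?B $ j - ?A $ j \<le> b $ j - a $ j"
    using comparable unfolding comparable_in_def by auto
  then consider
      "?B $ j \<le> ?A $ j" "?A $ j - ?B $ j < ?A $ i - ?B $ i" "?A $ i - ?B $ i \<le> a $ i - b $ i"
    | "?A $ i \<le> ?B $ i" "?B $ i - ?A $ i < ?B $ j - ?A $ j" "?B $ j - ?A $ j \<le> b $ j - a $ j"
    by blast
  then show ?thesis
  proof cases
    case 1
    then show ?thesis
      by (intro gap_measure_less[of a b i j]) (use max ij other in auto)
  next
    case 2
    then have "gap_measure ?B ?A < gap_measure b a"
      by (intro gap_measure_less[of b a j i]) (use max ij other in auto)
    then show ?thesis by (simp add: gap_measure_commute)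
  qed
qed

lemma alg_B_tree:
  assumes B: "alg_B N x V" and x: "fst x = [a, b]" and P: "P a" "P b"
  shows finite_alg_B: "finite V"
    and blow_up_tree_alg_B: "blow_up_tree V"
    and leaves_alg_B: "v \<in> leaves V \<Longrightarrow> N (sop (poly_at x v))"
proof -
  obtain \<sigma> where \<sigma>: "\<And>v. v \<in> stages_B N \<sigma> x \<Longrightarrow> \<not> N (sop (poly_at x v)) \<Longrightarrow> max_degree_vars (poly_at x v) (\<sigma> v)"
      and V: "V = tree_B N \<sigma> x"
    using B unfolding alg_B_def by blast
  let ?act = "\<lambda>v. \<not> N (sop (poly_at x v))"
  let ?T = "\<lambda>v. alg_A N (fst (\<sigma> v)) (snd (\<sigma> v)) (pair_at x v)"
  let ?A = "\<lambda>v. fold subst_exp v a" and ?B = "\<lambda>v. fold subst_exp v b"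
  have stages: "stages_B N \<sigma> x = reach ?act ?T (@) []"
  proof (intro equalityI subsetI)
    fix v assume "v \<in> stages_B N \<sigma> x"
    then show "v \<in> reach ?act ?T (@) []"
      by induction (auto intro: reach.intros)
  next
    fix v assume "v \<in> reach ?act ?T (@) []"
    then show "v \<in> stages_B N \<sigma> x"
      by induction (auto intro: stages_B.intros)
  qed
  have tree: "V = staged_tree ?act ?T (@) (\<lambda>v. v) []"
    unfolding V tree_B_def staged_tree_def stages by auto
  have poly: "poly_at x v = [?A v, ?B v]" for v by (simp add: poly_at_eq x)
  have active: "max_degree_vars [?A v, ?B v] (\<sigma> v)" "\<not> (?A v \<le> ?B v \<or> ?B v \<le> ?A v)" "fst (\<sigma> v) \<noteq> snd (\<sigma> v)"
    if "v \<in> stages_B N \<sigma> x" "?act v" for v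
  proof -
    show 1: "max_degree_vars [?A v, ?B v] (\<sigma> v)" using \<sigma>[OF that] by (simp add: poly)
    show 2: "\<not> (?A v \<le> ?B v \<or> ?B v \<le> ?A v)"
      using that(2) N_iff[OF P_fold P_fold, OF P, of v v] by (simp add: poly)
    show "fst (\<sigma> v) \<noteq> snd (\<sigma> v)" using max_degree_vars_pair(1,2)[OF 1 2] by auto
  qed
  have subtree: "blow_up_tree (?T v) \<and> finite (?T v)" if "v \<in> stages_B N \<sigma> x" "?act v" for v
    using blow_up_tree_alg_A finite_alg_A active(3)[OF that] poly P_fold P by metis
  have step: "v @ u \<in> stages_B N \<sigma> x \<and> gap_measure (?A (v @ u)) (?B (v @ u)) < gap_measure (?A v) (?B v)"
    if "v \<in> stages_B N \<sigma> x" "?act v" "u \<in> leaves (?T v)" for v u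
    using gap_measure_leaf_alg_A[OF active(2,1)[OF that(1,2)] poly P_fold P_fold that(3)] P
      stages_B.next_stage[OF that] by simp
  \<comment> \<open>Being a stage belongs to the invariant because \<sigma> is constrained at stages
    only.\<close>
  note staged = staged_tree[where node = "\<lambda>v. v" and Inv = "\<lambda>v. v \<in> stages_B N \<sigma> x"
      and m = "\<lambda>v. gap_measure (?A v) (?B v)" and act = ?act and T = ?T and nxt = "(@)" and ?t0.0 = "[]",
      folded tree, OF _ subtree step stages_B.root, simplified]
  show "finite V" "blow_up_tree V" by (rule staged; assumption)+
  show "v \<in> leaves V \<Longrightarrow> N (sop (poly_at x v))"
    using staged(3) by auto
qed

end

section \<open>Local normal crossing blow-up\<close>

lemma binomial_test_normal_crossing:
  "binomial_test normal_crossing (\<lambda>a :: nat ^ 'd. \<forall>l. even (a $ l))"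
  by unfold_locales (auto simp: subst_exp_def restrict_vars_def normal_crossing_even_pair_iff)

lemma binomial_test_local_normal_crossing:
  "binomial_test local_normal_crossing (\<lambda>a :: nat ^ 'd. True)"
  by unfold_locales (auto simp: local_normal_crossing_pair_iff)

lemma stopping_test_binomial:
  fixes a b :: "nat ^ 'd"
  obtains P where "binomial_test (stopping_test [a, b]) P" "P a" "P b"
proof (cases "[a, b] \<in> SP_nonneg 2")
  case True
  then show ?thesis
    using that[OF _ SP_nonneg_2_even[OF True]] binomial_test_normal_crossing by (simp add: stopping_test_def)
next
  case False
  then show ?thesis
    using that[of "\<lambda>_. True"] binomial_test_local_normal_crossing by (simp add: stopping_test_def)
qed

lemma alg_B_stopping_test:
  fixes a b :: "nat ^ 'd"
  assumes "alg_B (stopping_test [a, b]) ([a, b], k) V"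
  shows finite_alg_B_stopping_test: "finite V"
    and blow_up_tree_alg_B_stopping_test: "blow_up_tree V"
    and leaves_alg_B_stopping_test: "v \<in> leaves V \<Longrightarrow>
      fold subst_exp v a \<le> fold subst_exp v b \<or> fold subst_exp v b \<le> fold subst_exp v a"
proof -
  obtain P where P: "binomial_test (stopping_test [a, b]) P" "P a" "P b"
    by (rule stopping_test_binomial)
  note B = binomial_test.alg_B_tree[OF P(1) assms _ P(2,3), simplified]
  show "finite V" "blow_up_tree V" by (rule B)+
  show "fold subst_exp v a \<le> fold subst_exp v b \<or> fold subst_exp v b \<le> fold subst_exp v a"
    if "v \<in> leaves V"
    using B(3)[OF that] binomial_test.N_iff[OF P(1) binomial_test.P_fold binomial_test.P_fold, OF P(1,2) P(1,3), of v v]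
    by (simp add: poly_at_eq)
qed

lemma exists_alg_C: "\<exists>V. alg_C x V"
proof -
  define \<T> where "\<T> t = (SOME V. alg_B (stopping_test (fst (subproblem x t))) (subproblem x t) V)" for t
  have "alg_B (stopping_test (fst (subproblem x t))) (subproblem x t) (\<T> t)" for t
  proof -
    have "length (fst (subproblem x t)) = 2" by (cases t) simp
    then show ?thesis unfolding \<T>_def by (rule someI_ex[OF exists_alg_B])
  qed
  then show ?thesis unfolding alg_C_def by blast
qed

section \<open>The invariant of the counters\<close>

definition divides_terms_below :: "(nat ^ 'd) list \<Rightarrow> nat \<Rightarrow> nat \<Rightarrow> bool" where
  "divides_terms_below h m n \<longleftrightarrow> (\<forall>k. 1 \<le> k \<longrightarrow> k < n \<longrightarrow> h ! (m - 1) \<le> h ! (k - 1))"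

text \<open>The smaller counter marks a term that divides all terms before the larger one, which
  marks the next term to compare. The value \<open>length (fst x) + 1\<close> of the larger counter
  means that all terms have been compared.\<close>

fun counters_ok :: "('d::finite) pair \<Rightarrow> 'd stage \<Rightarrow> bool" where
  "counters_ok x (v, n1, n2) \<longleftrightarrow> 1 \<le> n1 \<and> 1 \<le> n2 \<and> n1 \<noteq> n2 \<and> max n1 n2 \<le> length (fst x) + 1 \<and>
     divides_terms_below (poly_at x v) (min n1 n2) (max n1 n2)"

lemma counters_ok_next:
  assumes ok: "counters_ok x (v, n1, n2)" and n: "n1 \<le> length (fst x)" "n2 \<le> length (fst x)"
    and comparable: "poly_at x (v @ u) ! (n1 - 1) \<le> poly_at x (v @ u) ! (n2 - 1) \<or>
      poly_at x (v @ u) ! (n2 - 1) \<le> poly_at x (v @ u) ! (n1 - 1)"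
  shows "counters_ok x (v @ u, next_counters (poly_at x (v @ u)) (n1, n2))"
proof -
  let ?h = "poly_at x (v @ u)"
  have nth: "?h ! k = fold subst_exp u (poly_at x v ! k)" if "k < length (fst x)" for k
    using that by (simp add: poly_at_eq)
  have old: "?h ! (min n1 n2 - 1) \<le> ?h ! (k - 1)" if "1 \<le> k" "k < max n1 n2" for k
  proof -
    have "k - 1 < length (fst x)" "min n1 n2 - 1 < length (fst x)"
      using that ok n by auto
    then show ?thesis
      using ok that by (auto simp: nth divides_terms_below_def intro: fold_subst_exp_mono)
  qed
  \<comment> \<open>\<open>m\<close> is the counter that is kept. It marks the divisor of the two
    compared terms, and by transitivity a divisor of all earlier ones.\<close>
  define m where "m = (if ?h ! (n1 - 1) \<le> ?h ! (n2 - 1) then n1 else n2)"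
  have m: "m \<in> {n1, n2}" "?h ! (m - 1) \<le> ?h ! (n1 - 1)" "?h ! (m - 1) \<le> ?h ! (n2 - 1)"
    using comparable by (auto simp: m_def)
  have "?h ! (m - 1) \<le> ?h ! (k - 1)" if "1 \<le> k" "k < max n1 n2 + 1" for k
  proof (cases "k = max n1 n2")
    case True
    then show ?thesis using m by (simp add: max_def)
  next
    case False
    have "?h ! (m - 1) \<le> ?h ! (min n1 n2 - 1)" using m by (simp add: min_def)
    also have "\<dots> \<le> ?h ! (k - 1)" using that False by (intro old) auto
    finally show ?thesis .
  qed
  then have "divides_terms_below ?h m (max n1 n2 + 1)"
    unfolding divides_terms_below_def by blast
  moreover have "next_counters ?h (n1, n2) = (if m = n1 then (m, max n1 n2 + 1) else (max n1 n2 + 1, m))"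
    using ok by (auto simp: m_def)
  ultimately show ?thesis
    using ok n m(1) by (auto simp: max_def min_def)
qed

text \<open>Each stage raises the larger counter by one, which bounds the number of stages along a
  branch. A branch ends at a local normal crossing or when the comparisons are exhausted, and then
  one term divides all the others.\<close>

lemma alg_C_tree:
  fixes x :: "('d::finite) pair"
  assumes C: "alg_C x V" and nonempty: "fst x \<noteq> []"
  shows finite_alg_C: "finite V"
    and blow_up_tree_alg_C: "blow_up_tree V"
    and leaves_alg_C: "v \<in> leaves V \<Longrightarrow> local_normal_crossing (sop (poly_at x v))"
proof -
  obtain \<T> where \<T>: "\<And>t. t \<in> stages_C \<T> x \<Longrightarrow> active x t \<Longrightarrow>
        alg_B (stopping_test (fst (subproblem x t))) (subproblem x t) (\<T> t)"
      and V: "V = tree_C \<T> x"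
    using C unfolding alg_C_def by blast
  define nxt where "nxt t u = (fst t @ u, next_counters (poly_at x (fst t @ u)) (snd t))" for t :: "'d stage" and u
  have nxt: "nxt (v, n) u = (v @ u, next_counters (poly_at x (v @ u)) n)" for v n u
    by (simp add: nxt_def)
  have stages: "stages_C \<T> x = reach (active x) \<T> nxt ([], 1, 2)"
  proof (intro equalityI subsetI)
    fix t assume "t \<in> stages_C \<T> x"
    then have "(fst t, snd t) \<in> stages_C \<T> x" by simp
    then have "(fst t, snd t) \<in> reach (active x) \<T> nxt ([], 1, 2)"
    proof (induction rule: stages_C.induct)
      case (next_stage v n1 n2 u)
      then show ?case
        using reach.step[of "(v, n1, n2)" "active x" \<T> nxt _ u] unfolding nxt by blast
    qed (rule reach.root)
    then show "t \<in> reach (active x) \<T> nxt ([], 1, 2)" by simp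
  next
    fix t assume "t \<in> reach (active x) \<T> nxt ([], 1, 2)"
    then show "t \<in> stages_C \<T> x"
    proof induction
      case (step t u)
      obtain v n1 n2 where "t = (v, n1, n2)" by (cases t)
      with step show ?case
        using stages_C.next_stage[of v n1 n2 \<T> x u] by (simp only: nxt)
    qed (rule stages_C.root)
  qed
  have tree: "V = staged_tree (active x) \<T> nxt fst ([], 1, 2)"
    unfolding V tree_C_def staged_tree_def stages by auto
  let ?Inv = "\<lambda>t. t \<in> stages_C \<T> x \<and> counters_ok x t"
  let ?m = "\<lambda>t :: 'd stage. length (fst x) + 1 - max (fst (snd t)) (snd (snd t))"
  have root: "?Inv ([], 1, 2)"
  proof -
    have "k = 1" if "1 \<le> k" "k < 2" for k :: nat using that by simp
    then have "divides_terms_below (poly_at x []) 1 2"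
      unfolding divides_terms_below_def by blast
    \<comment> \<open>With at least one term the initial counter 2 is within the bound
      \<open>length (fst x) + 1\<close>.\<close>
    then have "counters_ok x ([], 1, 2)" using nonempty by (simp add: Suc_le_eq numeral_2_eq_2)
    then show ?thesis using stages_C.root[of \<T> x] by blast
  qed
  have sub: "blow_up_tree (\<T> t) \<and> finite (\<T> t)" if "?Inv t" "active x t" for t
    using \<T>[of t] that by (cases t) (auto intro: alg_B_stopping_test)
  have step: "?Inv (nxt t u) \<and> ?m (nxt t u) < ?m t" if t: "?Inv t" "active x t" "u \<in> leaves (\<T> t)" for t u
  proof -
    obtain v n1 n2 where vn: "t = (v, n1, n2)" by (cases t)
    have n: "n1 \<le> length (fst x)" "n2 \<le> length (fst x)" "1 \<le> n1" "1 \<le> n2"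
      using t by (auto simp: vn)
    have "alg_B (stopping_test [poly_at x v ! (n1 - 1), poly_at x v ! (n2 - 1)])
        ([poly_at x v ! (n1 - 1), poly_at x v ! (n2 - 1)], snd (pair_at x v)) (\<T> t)"
      using \<T>[of t] t by (simp add: vn)
    from leaves_alg_B_stopping_test[OF this t(3)]
    have "counters_ok x (nxt t u)"
      using counters_ok_next[of x v n1 n2 u] t n by (auto simp: vn nxt poly_at_eq)
    moreover have "nxt t u \<in> stages_C \<T> x"
      using t unfolding stages by (auto intro: reach.step)
    moreover have "?m (nxt t u) < ?m t"
      using n by (auto simp: vn nxt)
    ultimately show ?thesis by blast
  qed
  have node: "fst (nxt t u) = fst t @ u" for t u by (simp add: nxt_def)
  note staged = staged_tree[where node = fst and nxt = nxt and Inv = ?Inv and m = ?m and act = "active x"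
      and T = \<T> and ?t0.0 = "([], 1, 2)", folded tree, OF node sub step root fst_conv]
  show "finite V" "blow_up_tree V" by (rule staged; assumption)+
  show "local_normal_crossing (sop (poly_at x v))" if v: "v \<in> leaves V"
  proof -
    have "leaves V = fst ` {t \<in> reach (active x) \<T> nxt ([], 1, 2). \<not> active x t}"
      by (rule staged; assumption)
    with v obtain n1 n2 where vn: "(v, n1, n2) \<in> reach (active x) \<T> nxt ([], 1, 2)"
        "\<not> active x (v, n1, n2)" by auto
    have "?Inv (v, n1, n2)"
      by (rule reach_invariant[OF vn(1), where Inv = ?Inv]) (use root step in blast)+
    then have ok: "counters_ok x (v, n1, n2)" by blast
    show ?thesis
    proof (rule ccontr)
      assume not: "\<not> local_normal_crossing (sop (poly_at x v))"
      let ?h = "poly_at x v" and ?m = "min n1 n2"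
      have len: "length ?h = length (fst x)" by (simp add: poly_at_eq)
      \<comment> \<open>An inactive stage without local normal crossing has a counter beyond the
        last term, and the invariant allows an excess of one only.\<close>
      have max: "max n1 n2 = length ?h + 1" using vn(2) not ok len by auto
      then have "?m - 1 < length ?h" using ok by auto
      then have "?h ! (?m - 1) \<in> set ?h" by simp
      moreover have "?h ! (?m - 1) \<le> c" if c: "c \<in> set ?h" for c
      proof -
        obtain k where "k < length ?h" "c = ?h ! k" using c by (auto simp: in_set_conv_nth)
        then show ?thesis
          using ok max unfolding counters_ok.simps divides_terms_below_def
          by (metis One_nat_def Suc_eq_plus1 Suc_leI Suc_less_eq diff_Suc_1 zero_less_Suc)
      qed
      ultimately show False using local_normal_crossing_sop not by blast
    qed
  qed
qed

text \<open>The choice among variables of maximum degree is left open, so outputs are shown to exist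
  and every output is treated. For \<open>n = 0\<close> the polynomial would be zero, which is not a
  local normal crossing.\<close>

theorem mainTheorem1:
  fixes s g :: "real ^ 'd"
  assumes s_pos: "\<forall>i. s $ i > 0"
    and g: "g = (\<chi> i. s $ i - 1)"
  shows "(\<forall>f :: (nat ^ 'd) list. f \<in> SP_nonneg 2 \<longrightarrow>
            (\<exists>V. alg_B normal_crossing (f, g) V) \<and>
            (\<forall>V. alg_B normal_crossing (f, g) V \<longrightarrow>
               blow_up_tree V \<and> finite V \<and>
               (\<forall>v \<in> leaves V. normal_crossing (sop (poly_at (f, g) v)))))
       \<and> (\<forall>(n :: nat) (f :: (nat ^ 'd) list). n \<ge> 1 \<longrightarrow> f \<in> SP_nonneg n \<longrightarrow>
            (\<exists>V. alg_C (f, g) V) \<and>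
            (\<forall>V. alg_C (f, g) V \<longrightarrow>
               blow_up_tree V \<and> finite V \<and>
               (\<forall>v \<in> leaves V. local_normal_crossing (sop (poly_at (f, g) v)))))"
proof (intro conjI allI impI ballI)
  fix f :: "(nat ^ 'd) list" assume f: "f \<in> SP_nonneg 2"
  then have len: "length f = 2" by (simp add: SP_nonneg_def SP_def)
  then show "\<exists>V. alg_B normal_crossing (f, g) V" by (simp add: exists_alg_B)
  obtain a b where ab: "f = [a, b]"
    using len by (auto simp: numeral_2_eq_2 length_Suc_conv)
  note even = SP_nonneg_2_even[OF f[unfolded ab]]
  fix V assume V: "alg_B normal_crossing (f, g) V"
  note B = binomial_test.alg_B_tree[OF binomial_test_normal_crossing V, of a b]
  show "blow_up_tree V" "finite V" using B even by (simp_all add: ab)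
  show "normal_crossing (sop (poly_at (f, g) v))" if "v \<in> leaves V" for v
    using B(3) even that by (simp add: ab)
next
  fix n :: nat and f :: "(nat ^ 'd) list"
  assume "n \<ge> 1" "f \<in> SP_nonneg n"
  then have f: "fst (f, g) \<noteq> []" by (auto simp: SP_nonneg_def SP_def)
  show "\<exists>V. alg_C (f, g) V" by (rule exists_alg_C)
  fix V assume V: "alg_C (f, g) V"
  show "blow_up_tree V" "finite V" by (rule alg_C_tree[OF V f])+
  show "local_normal_crossing (sop (poly_at (f, g) v))" if "v \<in> leaves V" for v
    using that by (rule leaves_alg_C[OF V f])
qed

end
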